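(* Let $(\mathcal{G}(g^j,\Lambda^j))_{j\in\mathcal{J}}$ be a family of tight Gabor frames for $\mathbf{L}^2(\mathbb{R}^d)$, where $\Lambda^j=\alpha_j\mathbb{Z}^d\times\beta_j\mathbb{Z}^d$ and every window $g^j$ has compact support. Suppose $\sup_{j\in\mathcal{J}}\|g^j\|_{S_0}=C_g<\infty$ and $C_{\Lambda^j}=\left(\frac1{\alpha_j}+1\right)^d\left(\frac1{\beta_j}+1\right)^d\le C_\Lambda<\infty$ for all $j\in\mathcal{J}$. Let $(\psi_r)_{r\in\mathcal{I}}$ be a partition of unity on $\mathbb{R}^d$ of height $n_0$ consisting of compactly supported functions $\psi_r$, and let $m:\mathcal{I}\to\mathcal{J}$ be a mapping assigning a frame $\mathcal{G}(g^{m(r)},\Lambda^{m(r)})$ to each $r\in\mathcal{I}$. Assume that index sets $$\mathcal{X}^r=\{(n\alpha_{m(r)},k\beta_{m(r)}): n\in\mathbb{Z}^d\cap[n^l_r,n^u_r],\ k\in\mathbb{Z}^d\}\subset\Lambda^{m(r)}$$ are chosen such that for all $r\in\mathcal{I}$ and all $\lambda=(n\alpha_{m(r)},k\beta_{m(r)})\in\Lambda^{m(r)}$ with $n\notin[n^l_r,n^u_r]$ one has $\psi_r\cdot\pi(\lambda)g^{m(r)}\equiv0$. Then the union of the subfamilies $\bigcup_{r\in\mathcal{I}}\{\pi(\lambda)g^{m(r)}:\lambda\in\mathcal{X}^r\}$ is a frame for $\mathbf{L}^2(\mathbb{R}^d)$ with a lower frame bound given by $1/(n_0C_\Lambda C_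g^2)$.
   Context: For $\lambda=(x,\omega)\in\mathbb{R}^{2d}$, $\pi(\lambda)g(t)=e^{2\pi i t\cdot\omega}g(t-x)$; $\mathcal{G}(g,\Lambda)=\{\pi(\lambda)g:\lambda\in\Lambda\}$. A family $(f_k)_{k\in K}$ in $\mathbf{L}^2(\mathbb{R}^d)$ is a frame with lower and upper frame bounds $A,B>0$ if $A\|f\|_2^2\le\sum_{k\in K}|\langle f,f_k\rangle|^2\le B\|f\|_2^2$ for all $f\in\mathbf{L}^2(\mathbb{R}^d)$; it is tight if $A=B$, in which case $f=\frac1A\sum_{k}\langle f,f_k\rangle f_k$. The union of subfamilies is understood as the family indexed by all pairs $(r,\lambda)$ with $r\in\mathcal{I}$, $\lambda\in\mathcal{X}^r$, so the frame inequality involves $\sum_{r\in\mathcal{I}}\sum_{\lambda\in\mathcal{X}^r}|\langle f,\pi(\lambda)g^{m(r)}\rangle|^2$. With $g_0(x)=e^{-\pi\|x\|^2}$ and $\mathcal{V}_{g_0}f(\lambda)=\langle f,\pi(\lambda)g_0\rangle$, $S_0(\mathbb{R}^d)=\{f\in\mathbf{L}^2(\mathbb{R}^d):\|f\|_{S_0}=\|\mathcal{V}_{g_0}f\|_{\mathbf{L}^1(\mathbb{R}^{2d})}<\infty\}$. A partition of unity on $\mathbb{R}^d$ of height $n_0$ is here a bounded admissible partition of unity: a family of non-negative functions $(\psi_r)_{r\in\mathcal{I}}$ with $\sum_r\psi_r\equiv1$ and $\operatorname{supp}\psi_r\subseteq B_{R_r}(x_r)$, where the balls $B_{R_r}(x_r)$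 cover $\mathbb{R}^d$ and $|\{s\in\mathcal{I}:B_{R_r}(x_r)\cap B_{R_s}(x_s)\neq\emptyset\}|\le n_0$ for all $r\in\mathcal{I}$. Standing assumption: for every $\rho>0$ there is $n_0(\rho)\in\mathbb{N}$ with $|\{s\in\mathcal{I}: B_{R_r+\rho}(x_r)\cap B_{R_s+\rho}(x_s)\neq\emptyset\}|\le n_0(\rho)$ for all $r\in\mathcal{I}$. Here $n^l_r,n^u_r$ are integer bounds (for $d>1$, vectors in $\mathbb{Z}^d$, with $[n^l_r,n^u_r]$ understood componentwise).
   Formalization: The tight frames are assumed to have frame bounds A_j ≥ 1 (rescaling windows refutes the constant otherwise); the upper frame bound is claimed only if, for one ρ>0, all retained atoms of index r are supported in B_{R_r+ρ}(x_r), since oversized boxes [n^l_r,n^u_r] make the frame sum infinite. *)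

theory Defs
  imports "HOL-Analysis.Analysis"
begin

text \<open>
  Elements of $L^2(R^d)$ are represented by square-integrable Borel functions; every definition
  below is insensitive to changes on null sets unless it is about pointwise data.
\<close>

definition L2 :: "(real ^ 'd \<Rightarrow> complex) set" where
  "L2 = {f. f \<in> borel_measurable lborel \<and> integrable lborel (\<lambda>t. (cmod (f t))\<^sup>2)}"

definition L2_norm :: "(real ^ 'd \<Rightarrow> complex) \<Rightarrow> real" where
  "L2_norm f = sqrt (LINT t|lborel. (cmod (f t))\<^sup>2)"

definition L2_inner :: "(real ^ 'd \<Rightarrow> complex) \<Rightarrow> (real ^ 'd \<Rightarrow> complex) \<Rightarrow> complex" where
  "L2_inner f h = (LINT t|lborel. f t * cnj (h t))"

definition tf_shift ::
  "(real ^ 'd) \<times> (real ^ 'd) \<Rightarrow> (real ^ 'd \<Rightarrow> complex) \<Rightarrow> (real ^ 'd \<Rightarrow> complex)" where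
  "tf_shift z h = (\<lambda>t. cis (2 * pi * (t \<bullet> snd z)) * h (t - fst z))"

definition gauss :: "real ^ 'd \<Rightarrow> complex" where
  "gauss t = of_real (exp (- pi * (norm t)\<^sup>2))"

definition S0_norm :: "(real ^ 'd \<Rightarrow> complex) \<Rightarrow> ennreal" where
  "S0_norm f = (\<integral>\<^sup>+ z. ennreal (cmod (L2_inner f (tf_shift z gauss))) \<partial>lborel)"

definition S0 :: "(real ^ 'd \<Rightarrow> complex) set" where
  "S0 = {f \<in> L2. S0_norm f < \<infinity>}"

text \<open>Compact support of an equivalence class modulo null sets.\<close>

definition compactly_supported :: "(real ^ 'd \<Rightarrow> complex) \<Rightarrow> bool" where
  "compactly_supported f \<longleftrightarrow> (\<exists>K. compact K \<and> (AE t in lborel. t \<notin> K \<longrightarrow> f t = 0))"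

text \<open>
  The sums over the index set are taken in the extended non-negative reals, so that a divergent
  sum has the value $\infty$ (and violates every upper bound).
\<close>

definition lower_frame_bound :: "'k set \<Rightarrow> ('k \<Rightarrow> real ^ 'd \<Rightarrow> complex) \<Rightarrow> real \<Rightarrow> bool" where
  "lower_frame_bound K \<phi> A \<longleftrightarrow> 0 < A \<and>
     (\<forall>f\<in>L2. ennreal (A * (L2_norm f)\<^sup>2) \<le> (\<Sum>\<^sub>\<infinity>k\<in>K. ennreal ((cmod (L2_inner f (\<phi> k)))\<^sup>2)))"

definition upper_frame_bound :: "'k set \<Rightarrow> ('k \<Rightarrow> real ^ 'd \<Rightarrow> complex) \<Rightarrow> real \<Rightarrow> bool" where
  "upper_frame_bound K \<phi> B \<longleftrightarrow> 0 < B \<and>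
     (\<forall>f\<in>L2. (\<Sum>\<^sub>\<infinity>k\<in>K. ennreal ((cmod (L2_inner f (\<phi> k)))\<^sup>2)) \<le> ennreal (B * (L2_norm f)\<^sup>2))"

definition frame :: "'k set \<Rightarrow> ('k \<Rightarrow> real ^ 'd \<Rightarrow> complex) \<Rightarrow> real \<Rightarrow> real \<Rightarrow> bool" where
  "frame K \<phi> A B \<longleftrightarrow> (\<forall>k\<in>K. \<phi> k \<in> L2) \<and> lower_frame_bound K \<phi> A \<and> upper_frame_bound K \<phi> B"

definition tight_frame :: "'k set \<Rightarrow> ('k \<Rightarrow> real ^ 'd \<Rightarrow> complex) \<Rightarrow> real \<Rightarrow> bool" where
  "tight_frame K \<phi> A \<longleftrightarrow> frame K \<phi> A A"

definition int_vec :: "int ^ 'd \<Rightarrow> real ^ 'd" where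
  "int_vec n = (\<chi> i. of_int (n $ i))"

definition tf_lattice :: "real \<Rightarrow> real \<Rightarrow> ((real ^ 'd) \<times> (real ^ 'd)) set" where
  "tf_lattice a b = {(a *\<^sub>R int_vec n, b *\<^sub>R int_vec k) | n k. True}"

text \<open>The order on \<^typ>\<open>int ^ 'd\<close> is componentwise, so the interval below is a box in $Z^d$.\<close>

definition tf_strip ::
  "real \<Rightarrow> real \<Rightarrow> int ^ 'd \<Rightarrow> int ^ 'd \<Rightarrow> ((real ^ 'd) \<times> (real ^ 'd)) set" where
  "tf_strip a b nl nu = {(a *\<^sub>R int_vec n, b *\<^sub>R int_vec k) | n k. n \<in> {nl..nu}}"

definition ball_overlap ::
  "'i set \<Rightarrow> ('i \<Rightarrow> real ^ 'd) \<Rightarrow> ('i \<Rightarrow> real) \<Rightarrow> real \<Rightarrow> nat \<Rightarrow> bool" where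
  "ball_overlap I x R \<rho> N \<longleftrightarrow>
     (\<forall>r\<in>I. finite {s\<in>I. ball (x r) (R r + \<rho>) \<inter> ball (x s) (R s + \<rho>) \<noteq> {}} \<and>
             card {s\<in>I. ball (x r) (R r + \<rho>) \<inter> ball (x s) (R s + \<rho>) \<noteq> {}} \<le> N)"

definition partition_of_unity ::
  "'i set \<Rightarrow> ('i \<Rightarrow> real ^ 'd) \<Rightarrow> ('i \<Rightarrow> real) \<Rightarrow> ('i \<Rightarrow> real ^ 'd \<Rightarrow> real) \<Rightarrow> nat \<Rightarrow> bool" where
  "partition_of_unity I x R \<psi> n0 \<longleftrightarrow>
     (\<forall>r\<in>I. \<forall>t. 0 \<le> \<psi> r t) \<and>
     (\<forall>t. ((\<lambda>r. \<psi> r t) has_sum 1) I) \<and>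
     (\<forall>r\<in>I. 0 < R r \<and> closure {t. \<psi> r t \<noteq> 0} \<subseteq> ball (x r) (R r)) \<and>
     (\<Union>r\<in>I. ball (x r) (R r)) = UNIV \<and>
     ball_overlap I x R 0 n0"

end

theory Submission
  imports
    Defs
    "HOL-Probability.Characteristic_Functions"
    "HOL-Real_Asymp.Real_Asymp"
begin

text \<open>
  Let \<open>F\<^sub>r\<close> be the set on which all the discarded atoms of index \<open>r\<close> vanish. Tightness of the
  \<open>r\<close>-th Gabor frame gives \<open>A \<parallel>f 1\<^sub>F\<parallel>\<^sup>2 \<le> \<Sum> |\<langle>f, \<pi>(\<lambda>) g\<rangle>|\<^sup>2\<close>, with \<open>F = F\<^sub>r\<close> and \<open>\<lambda>\<close> running over the
  retained index set only. Up to null sets the \<open>F\<^sub>r\<close> cover the space, because \<open>\<psi>\<^sub>r\<close> is supported in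
  \<open>F\<^sub>r\<close>, so summing over \<open>r\<close> yields the lower bound \<open>1\<close>, as \<open>A \<ge> 1\<close>. The functions \<open>\<psi>\<^sub>r\<close> need not be
  measurable, which is why \<open>F\<^sub>r\<close> takes their place.

  It remains to see that \<open>1 \<le> C\<^sub>\<Lambda> C\<^sub>g\<^sup>2\<close>. Testing the frame inequality on the time-frequency shifts of a
  Gaussian \<open>h\<close> and averaging over the lattice gives \<open>A (\<alpha>\<beta>)\<^sup>d \<parallel>h\<parallel>\<^sup>2 \<le> \<integral> |\<langle>g, \<pi>(z) h\<rangle>|\<^sup>2 dz\<close>. For
  increasingly narrow \<open>h\<close> the right-hand side is at most \<open>\<parallel>h\<parallel>\<^sup>2\<close> times the square of the \<open>S\<^sub>0\<close>-norm of
  \<open>g\<close>, up to a factor tending to \<open>1\<close>. Hence \<open>A (\<alpha>\<beta>)\<^sup>d \<le> C\<^sub>g\<^sup>2\<close>, while \<open>C\<^sub>\<Lambda> (\<alpha>\<beta>)\<^sup>d \<ge> 1\<close>. The same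
  estimate bounds \<open>A\<close> uniformly, which gives the upper frame bound.
\<close>

section \<open>Gaussian integrals\<close>

text \<open>The substitution \<open>s * x\<close> with \<open>s\<^sup>2 = 2 * pi * b\<close> turns
  the standard normal density into this Gaussian, so the value comes from the characteristic
  function of the normal distribution.\<close>

lemma has_bochner_integral_gaussian_cis_real:
  fixes b w :: real
  assumes "0 < b"
  shows "has_bochner_integral lborel
    (\<lambda>x. complex_of_real (exp (- pi * b * x\<^sup>2)) * cis (2 * pi * (x * w)))
    (complex_of_real (exp (- pi * w\<^sup>2 / b) / sqrt b))"
proof -
  define s where "s = sqrt (2 * pi * b)"
  have s: "0 < s" "s\<^sup>2 = 2 * pi * b" "s = sqrt (2 * pi) * sqrt b"
    using assms by (simp_all add: s_def flip: real_sqrt_mult)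
  define F where "F = (\<lambda>x. std_normal_density x *\<^sub>R cis (2 * pi * w / s * x))"
  have [measurable]: "cis \<in> borel_measurable borel"
    by (intro borel_measurable_continuous_onI continuous_intros)
  have int: "integrable lborel F"
    unfolding F_def
    by (rule Bochner_Integration.integrable_bound[of _ std_normal_density])
       auto
  have "integral\<^sup>L lborel F = char std_normal_distribution (2 * pi * w / s)"
    unfolding char_def F_def
    by (subst integral_density)
       (auto simp: cis_conv_exp)
  also have "\<dots> = complex_of_real (exp (- (2 * pi * w / s)\<^sup>2 / 2))"
    by (simp add: char_std_normal_distribution)
  also have "- (2 * pi * w / s)\<^sup>2 / 2 = - pi * w\<^sup>2 / b"
    using assms s by (simp add: power_divide power_mult_distrib field_simps power2_eq_square)
  finally have "has_bochner_integral lborel F (complex_of_real (exp (- pi * w\<^sup>2 / b)))"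
    using int by (simp add: has_bochner_integral_iff)
  then have "has_bochner_integral lborel (\<lambda>x. F (0 + s * x))
      (complex_of_real (exp (- pi * w\<^sup>2 / b)) /\<^sub>R \<bar>s\<bar>)"
    using s by (subst (asm) lborel_has_bochner_integral_real_affine_iff[of s _ _ 0]) auto
  then have "has_bochner_integral lborel (\<lambda>x. sqrt (2 * pi) *\<^sub>R F (0 + s * x))
      (sqrt (2 * pi) *\<^sub>R (complex_of_real (exp (- pi * w\<^sup>2 / b)) /\<^sub>R \<bar>s\<bar>))"
    by (rule has_bochner_integral_scaleR_right)
  moreover have "sqrt (2 * pi) *\<^sub>R F (0 + s * x) =
      complex_of_real (exp (- pi * b * x\<^sup>2)) * cis (2 * pi * (x * w))" for x
    using s assms unfolding F_def std_normal_density_def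
    by (simp add: scaleR_conv_of_real power_mult_distrib field_simps)
  moreover have "sqrt (2 * pi) *\<^sub>R (complex_of_real (exp (- pi * w\<^sup>2 / b)) /\<^sub>R \<bar>s\<bar>) =
      complex_of_real (exp (- pi * w\<^sup>2 / b) / sqrt b)"
    using s assms by (simp add: scaleR_conv_of_real field_simps)
  ultimately show ?thesis by simp
qed

text \<open>Both the Gaussian and the character factor over the coordinates, and Lebesgue measure is
  the image of a product measure. The integral is therefore a product of one-dimensional
  ones.\<close>

lemma has_bochner_integral_gaussian_cis:
  fixes w :: "'a::euclidean_space"
  assumes "0 < b"
  shows "has_bochner_integral lborel
    (\<lambda>t. complex_of_real (exp (- pi * b * (norm t)\<^sup>2)) * cis (2 * pi * (t \<bullet> w)))
    (complex_of_real (exp (- pi * (norm w)\<^sup>2 / b) / sqrt b ^ DIM('a)))"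
proof -
  let ?G = "\<lambda>j x. complex_of_real (exp (- pi * b * x\<^sup>2)) * cis (2 * pi * (x * (w \<bullet> j)))"
  interpret product_sigma_finite "\<lambda>_::'a. lborel :: real measure" ..
  have norm_sq: "(norm v)\<^sup>2 = (\<Sum>j\<in>Basis. (v \<bullet> j)\<^sup>2)" for v :: 'a
    unfolding power2_norm_eq_inner by (subst euclidean_inner) (simp add: power2_eq_square)
  have cis_sum: "cis (\<Sum>j\<in>B. f j) = (\<Prod>j\<in>B. cis (f j))" if "finite B" for B :: "'a set" and f
    using that by (induction B rule: finite_induct) (simp_all flip: cis_mult)
  have factor: "complex_of_real (exp (- pi * b * (norm t)\<^sup>2)) * cis (2 * pi * (t \<bullet> w)) =
      (\<Prod>j\<in>Basis. ?G j (t \<bullet> j))" for t :: 'a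
    by (simp add: prod.distrib norm_sq sum_distrib_left exp_sum euclidean_inner[of t w]
        flip: cis_sum of_real_prod)
  have int1: "integrable lborel (?G j)" "integral\<^sup>L lborel (?G j) =
      complex_of_real (exp (- pi * (w \<bullet> j)\<^sup>2 / b) / sqrt b)" for j
    using has_bochner_integral_gaussian_cis_real[OF assms, of "w \<bullet> j"]
    by (simp_all add: has_bochner_integral_iff)
  have meas: "(\<lambda>x. \<Prod>j\<in>Basis. ?G j (x \<bullet> j)) \<in> borel_measurable (borel :: 'a measure)"
    by (intro borel_measurable_continuous_onI continuous_intros)
  have meas_sum: "(\<lambda>x. \<Sum>b\<in>Basis. x b *\<^sub>R b) \<in> (\<Pi>\<^sub>M j\<in>(Basis :: 'a set). lborel) \<rightarrow>\<^sub>M borel"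
    by measurable
  have comp: "(\<Prod>j\<in>Basis. ?G j ((\<Sum>b\<in>Basis. x b *\<^sub>R b) \<bullet> j)) = (\<Prod>j\<in>Basis. ?G j (x j))"
    for x :: "'a \<Rightarrow> real"
    by (rule prod.cong) simp_all
  have "integrable lborel (\<lambda>t. \<Prod>j\<in>Basis. ?G j (t \<bullet> j))"
    by (subst lborel_eq, subst integrable_distr_eq[OF meas_sum meas], subst comp)
       (rule product_integrable_prod[OF finite_Basis int1(1)])
  moreover have "(\<integral>t. (\<Prod>j\<in>Basis. ?G j (t \<bullet> j)) \<partial>lborel) =
      (\<Prod>j\<in>Basis. complex_of_real (exp (- pi * (w \<bullet> j)\<^sup>2 / b) / sqrt b))"
    by (subst lborel_eq, subst integral_distr[OF meas_sum meas], subst comp,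
        subst product_integral_prod[OF finite_Basis int1(1)], subst int1(2)) (rule refl)
  moreover have exp_norm: "exp (- pi * (norm w)\<^sup>2 / b) = (\<Prod>j\<in>Basis. exp (- pi * (w \<bullet> j)\<^sup>2 / b))"
    by (simp add: norm_sq sum_distrib_left sum_divide_distrib sum_negf flip: exp_sum)
  then have "(\<Prod>j\<in>Basis. complex_of_real (exp (- pi * (w \<bullet> j)\<^sup>2 / b) / sqrt b)) =
      complex_of_real (exp (- pi * (norm w)\<^sup>2 / b) / sqrt b ^ DIM('a))"
    by (simp add: prod_dividef exp_norm)
  ultimately show ?thesis
    unfolding has_bochner_integral_iff factor by simp
qed

section \<open>Sums and integrals\<close>

lemma countable_tf_lattice: "countable (tf_lattice a b)"
proof -
  have "tf_lattice a b = (\<lambda>(n, k). (a *\<^sub>R int_vec n, b *\<^sub>R int_vec k)) ` UNIV"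
    by (auto simp: tf_lattice_def)
  then show ?thesis by (metis countable_image countableI_type)
qed

lemma infsum_ennreal_le_nn_integral_count_space:
  fixes f :: "'a \<Rightarrow> ennreal"
  shows "(\<Sum>\<^sub>\<infinity>x\<in>A. f x) \<le> (\<integral>\<^sup>+x. f x \<partial>count_space A)"
proof (subst nonneg_infsum_complete, simp, rule SUP_least)
  fix F assume "F \<in> {F. finite F \<and> F \<subseteq> A}"
  then have F: "finite F" "F \<subseteq> A" by auto
  have "sum f F = (\<integral>\<^sup>+x. f x * indicator F x \<partial>count_space A)"
    using F by (subst nn_integral_count_space'[of F]) auto
  also have "\<dots> \<le> (\<integral>\<^sup>+x. f x \<partial>count_space A)"
    by (intro nn_integral_mono) (auto simp: indicator_def)
  finally show "sum f F \<le> (\<integral>\<^sup>+x. f x \<partial>count_space A)" .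
qed

text \<open>Along an enumeration of an infinite \<open>A\<close>, the integral is a supremum of
  finite subsums.\<close>

lemma nn_integral_count_space_le_infsum_ennreal:
  fixes f :: "'a \<Rightarrow> ennreal"
  assumes "countable A"
  shows "(\<integral>\<^sup>+x. f x \<partial>count_space A) \<le> (\<Sum>\<^sub>\<infinity>x\<in>A. f x)"
proof (cases "finite A")
  case True
  then show ?thesis by (simp add: nn_integral_count_space_finite)
next
  case False
  have bij: "bij_betw (from_nat_into A) UNIV A"
    using assms False by (rule bij_betw_from_nat_into)
  have "(\<integral>\<^sup>+x. f x \<partial>count_space A) = (\<Sum>n. f (from_nat_into A n))"
    using nn_integral_bij_count_space[OF bij, of f] by (simp add: nn_integral_count_space_nat)
  also have "\<dots> = (SUP n. sum f (from_nat_into A ` {..<n}))"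
    using bij
    by (subst suminf_eq_SUP) (auto simp: bij_betw_def sum.reindex inj_on_subset)
  also have "\<dots> \<le> (\<Sum>\<^sub>\<infinity>x\<in>A. f x)"
    using bij
    by (subst nonneg_infsum_complete, simp) (intro SUP_mono, auto simp: bij_betw_def)
  finally show ?thesis .
qed

text \<open>This turns frame sums into integrals, where Tonelli's theorem permits interchanging them
  with integrals over space.\<close>

lemma infsum_ennreal_eq_nn_integral_count_space:
  fixes f :: "'a \<Rightarrow> ennreal"
  assumes "countable A"
  shows "(\<Sum>\<^sub>\<infinity>x\<in>A. f x) = (\<integral>\<^sup>+x. f x \<partial>count_space A)"
  using infsum_ennreal_le_nn_integral_count_space nn_integral_count_space_le_infsum_ennreal[OF assms]
  by (rule antisym)

text \<open>The sign \<open>s\<close> serves both the translations (\<open>s = 1\<close>) and the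
  reflections (\<open>s = -1\<close>).\<close>

lemma distr_lborel_signed_translation:
  fixes c :: "'a::euclidean_space"
  assumes "\<bar>s\<bar> = 1"
  shows "distr lborel borel (\<lambda>x. c + s *\<^sub>R x) = lborel"
  using lborel_affine[of s c] assms by (simp add: density_1)

lemma nn_integral_lborel_translate:
  fixes c :: "'a::euclidean_space"
  assumes [measurable]: "f \<in> borel_measurable borel"
  shows "(\<integral>\<^sup>+x. f (x + c) \<partial>lborel) = (\<integral>\<^sup>+x. f x \<partial>lborel)"
proof -
  have "(\<integral>\<^sup>+x. f x \<partial>lborel) = (\<integral>\<^sup>+x. f x \<partial>distr lborel borel (\<lambda>x. c + 1 *\<^sub>R x))"
    by (simp only: distr_lborel_signed_translation abs_one)
  also have "\<dots> = (\<integral>\<^sup>+x. f (x + c) \<partial>lborel)"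
    by (subst nn_integral_distr) (auto simp: add.commute)
  finally show ?thesis ..
qed

lemma nn_integral_lborel_reflect:
  fixes c :: "'a::euclidean_space"
  assumes [measurable]: "f \<in> borel_measurable borel"
  shows "(\<integral>\<^sup>+x. f (c - x) \<partial>lborel) = (\<integral>\<^sup>+x. f x \<partial>lborel)"
proof -
  have "(\<integral>\<^sup>+x. f x \<partial>lborel) = (\<integral>\<^sup>+x. f x \<partial>distr lborel borel (\<lambda>x. c + (-1) *\<^sub>R x))"
    by (simp only: distr_lborel_signed_translation abs_one abs_minus_cancel)
  also have "\<dots> = (\<integral>\<^sup>+x. f (c - x) \<partial>lborel)"
    by (subst nn_integral_distr) auto
  finally show ?thesis ..
qed

lemma integral_lborel_translate:
  fixes c :: "'a::euclidean_space" and f :: "'a \<Rightarrow> 'b::{banach, second_countable_topology}"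
  assumes [measurable]: "f \<in> borel_measurable borel"
  shows "(\<integral>x. f (x + c) \<partial>lborel) = (\<integral>x. f x \<partial>lborel)"
proof -
  have "(\<integral>x. f x \<partial>lborel) = (\<integral>x. f x \<partial>distr lborel borel (\<lambda>x. c + 1 *\<^sub>R x))"
    by (simp only: distr_lborel_signed_translation abs_one)
  also have "\<dots> = (\<integral>x. f (x + c) \<partial>lborel)"
    by (subst integral_distr) (auto simp: add.commute)
  finally show ?thesis ..
qed

section \<open>Time-frequency shifts\<close>

lemma borel_measurable_cis [measurable]: "cis \<in> borel_measurable borel"
  by (intro borel_measurable_continuous_onI continuous_intros)

lemma borel_measurable_cnj [measurable]: "cnj \<in> borel_measurable borel"
  by (intro borel_measurable_continuous_onI continuous_intros)

lemma borel_measurable_fst_snd [measurable]: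
  "fst \<in> (borel :: ('a::topological_space \<times> 'b::topological_space) measure) \<rightarrow>\<^sub>M borel"
  "snd \<in> (borel :: ('a::topological_space \<times> 'b::topological_space) measure) \<rightarrow>\<^sub>M borel"
  by (intro borel_measurable_continuous_onI continuous_intros)+

lemma L2_borel_measurable: "f \<in> L2 \<Longrightarrow> f \<in> borel_measurable borel"
  by (simp add: L2_def)

lemma L2_norm_sq: "(L2_norm f)\<^sup>2 = (\<integral>t. (cmod (f t))\<^sup>2 \<partial>lborel)"
  by (simp add: L2_norm_def)

lemma ennreal_L2_norm_sq:
  assumes "f \<in> L2"
  shows "ennreal ((L2_norm f)\<^sup>2) = (\<integral>\<^sup>+t. ennreal ((cmod (f t))\<^sup>2) \<partial>lborel)"
  using assms by (simp add: L2_norm_sq L2_def nn_integral_eq_integral)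

lemma L2_tf_shift:
  assumes "h \<in> L2"
  shows "tf_shift z h \<in> L2" "L2_norm (tf_shift z h) = L2_norm h"
proof -
  note [measurable] = L2_borel_measurable[OF assms]
  have sq: "(cmod (tf_shift z h t))\<^sup>2 = (cmod (h (t + (- fst z))))\<^sup>2" for t
    by (simp add: tf_shift_def norm_mult)
  have meas: "(\<lambda>t. (cmod (h t))\<^sup>2) \<in> borel_measurable borel" by measurable
  have "(\<integral>\<^sup>+t. ennreal ((cmod (h t))\<^sup>2) \<partial>lborel) < \<infinity>"
    using assms by (simp add: L2_def integrable_iff_bounded)
  then have "(\<integral>\<^sup>+t. ennreal ((cmod (tf_shift z h t))\<^sup>2) \<partial>lborel) < \<infinity>"
    unfolding sq using meas by (subst nn_integral_lborel_translate) auto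
  moreover have m: "tf_shift z h \<in> borel_measurable borel"
    unfolding tf_shift_def by measurable
  ultimately show "tf_shift z h \<in> L2"
    by (simp add: L2_def integrable_iff_bounded)
  show "L2_norm (tf_shift z h) = L2_norm h"
    unfolding L2_norm_def sq by (subst integral_lborel_translate) (use meas in auto)
qed

lemma borel_measurable_L2_inner_tf_shift:
  assumes [measurable]: "g \<in> borel_measurable borel" "h \<in> borel_measurable borel"
  shows "(\<lambda>z. L2_inner g (tf_shift z h)) \<in> borel_measurable borel"
proof -
  have "(\<lambda>z. \<integral>t. g t * cnj (tf_shift z h t) \<partial>lborel) \<in> borel_measurable borel"
  proof (rule lborel.borel_measurable_lebesgue_integral)
    have "(\<lambda>(z, t). g t * cnj (tf_shift z h t)) \<in> borel_measurable (borel \<Otimes>\<^sub>M borel)"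
      unfolding tf_shift_def by measurable
    then show "(\<lambda>(z, t). g t * cnj (tf_shift z h t)) \<in> borel_measurable (borel \<Otimes>\<^sub>M lborel)"
      by (simp cong: measurable_cong_sets sets_pair_measure_cong)
  qed
  then show ?thesis unfolding L2_inner_def .
qed

text \<open>Translating the integration variable by \<open>fst l\<close> gives the conjugate of the
  other inner product, up to the unimodular phase \<open>p\<close>. The coefficients of all shifts
  of \<open>h\<close> thus become translates of a single function on phase space.\<close>

lemma cmod_L2_inner_tf_shift_tf_shift:
  assumes [measurable]: "g \<in> borel_measurable borel" "h \<in> borel_measurable borel"
  shows "cmod (L2_inner (tf_shift z h) (tf_shift l g)) = cmod (L2_inner g (tf_shift (z - l) h))"
proof -
  define F where "F t = tf_shift z h t * cnj (tf_shift l g t)" for t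
  have [measurable]: "F \<in> borel_measurable borel"
    unfolding F_def tf_shift_def by measurable
  define p where "p = cis (2 * pi * (fst l \<bullet> (snd z - snd l)))"
  have F: "F (t + fst l) = p * cnj (g t * cnj (tf_shift (z - l) h t))" for t
  proof -
    have "cis (2 * pi * ((t + fst l) \<bullet> snd z)) * cnj (cis (2 * pi * ((t + fst l) \<bullet> snd l)))
        = p * cis (2 * pi * (t \<bullet> (snd z - snd l)))"
      unfolding p_def by (simp add: cis_cnj cis_mult inner_simps algebra_simps)
    then show ?thesis
      unfolding F_def tf_shift_def
      by (simp add: algebra_simps) 
  qed
  have "L2_inner (tf_shift z h) (tf_shift l g) = (\<integral>t. F t \<partial>lborel)"
    by (simp add: L2_inner_def F_def)
  also have "\<dots> = (\<integral>t. F (t + fst l) \<partial>lborel)"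
    by (simp add: integral_lborel_translate)
  also have "\<dots> = p * cnj (L2_inner g (tf_shift (z - l) h))"
    unfolding F L2_inner_def by (simp only: integral_mult_right_zero Bochner_Integration.integral_cnj)
  finally show ?thesis
    by (simp add: norm_mult p_def)
qed

text \<open>Corresponding coordinates of the two points differ by less than one lattice step, and
  integers at distance below 1 are equal. So the lattice translates of the open fundamental box are
  disjoint.\<close>

lemma tf_lattice_translate_box_unique:
  fixes l l' z :: "(real ^ 'd) \<times> (real ^ 'd)"
  assumes "0 < a" "0 < b" and l: "l \<in> tf_lattice a b" "l' \<in> tf_lattice a b"
    and box: "z + l \<in> box 0 (\<chi> i. a) \<times> box 0 (\<chi> i. b)" "z + l' \<in> box 0 (\<chi> i. a) \<times> box 0 (\<chi> i. b)"
  shows "l = l'"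
proof -
  obtain n k n' k' where eq: "l = (a *\<^sub>R int_vec n, b *\<^sub>R int_vec k)"
      "l' = (a *\<^sub>R int_vec n', b *\<^sub>R int_vec k')"
    using l by (auto simp: tf_lattice_def)
  have step: "p = q" if "0 < c" "0 < s + c * of_int p" "s + c * of_int p < c"
      "0 < s + c * of_int q" "s + c * of_int q < c" for c s :: real and p q :: int
  proof -
    have "c * (of_int p - of_int q) < c * 1" "c * (of_int q - of_int p) < c * 1"
      using that by (simp_all add: algebra_simps)
    then have "of_int p - of_int q < (1::real)" "of_int q - of_int p < (1::real)"
      using that(1) by (simp_all only: mult_less_cancel_left_pos)
    then show ?thesis by linarith
  qed
  have "n $ i = n' $ i" "k $ i = k' $ i" for i
    using box step[OF assms(1), of "fst z $ i"] step[OF assms(2), of "snd z $ i"]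
    by (cases z; auto simp: eq mem_box_cart int_vec_def)+
  then have "n = n'" "k = k'" by (simp_all add: vec_eq_iff)
  then show ?thesis by (simp add: eq)
qed

text \<open>
  The frame inequality for all shifts of \<open>h\<close>, integrated over a fundamental box of the lattice,
  unfolds to an integral over phase space.
\<close>

lemma lower_frame_bound_average:
  fixes g h :: "real ^ 'd \<Rightarrow> complex"
  assumes ab: "0 < a" "0 < b"
    and frame: "lower_frame_bound (tf_lattice a b) (\<lambda>z. tf_shift z g) A"
    and g: "g \<in> L2" and h: "h \<in> L2"
  shows "ennreal (A * (L2_norm h)\<^sup>2 * (a * b) ^ CARD('d))
    \<le> (\<integral>\<^sup>+z. ennreal ((cmod (L2_inner g (tf_shift z h)))\<^sup>2) \<partial>lborel)"
proof -
  note [measurable] = L2_borel_measurable[OF g] L2_borel_measurable[OF h]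
  define C where "C = (box 0 (\<chi> i. a) \<times> box 0 (\<chi> i. b) :: ((real ^ 'd) \<times> (real ^ 'd)) set)"
  define Q where "Q z = ennreal ((cmod (L2_inner g (tf_shift z h)))\<^sup>2)" for z
  let ?L = "tf_lattice a b :: ((real ^ 'd) \<times> (real ^ 'd)) set"
  have [measurable]: "Q \<in> borel_measurable borel"
    unfolding Q_def using borel_measurable_L2_inner_tf_shift[of g h] by measurable
  have [measurable]: "C \<in> sets borel"
    unfolding C_def by (intro borel_open open_Times open_box)
  have box: "emeasure lborel (box 0 (\<chi> i. c) :: (real ^ 'd) set) = ennreal (c ^ CARD('d))"
    if "0 < c" for c :: real
  proof -
    have *: "(\<chi> i. c) \<bullet> u = c" if "u \<in> Basis" for u :: "real ^ 'd"
      using that by (auto simp: Basis_vec_def inner_axis)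
    show ?thesis using that by (simp add: emeasure_lborel_box * )
  qed
  have emC: "emeasure lborel C = ennreal ((a * b) ^ CARD('d))"
    unfolding C_def lborel_prod[symmetric]
    using ab by (simp add: lborel.emeasure_pair_measure_Times box power_mult_distrib ennreal_mult)
  have "ennreal (A * (L2_norm h)\<^sup>2 * (a * b) ^ CARD('d))
      = (\<integral>\<^sup>+z. ennreal (A * (L2_norm h)\<^sup>2) * indicator C z \<partial>lborel)"
    using frame ab by (simp add: nn_integral_cmult_indicator emC ennreal_mult' lower_frame_bound_def)
  also have "\<dots> \<le> (\<integral>\<^sup>+z. (\<integral>\<^sup>+l. Q (z - l) * indicator C z \<partial>count_space ?L) \<partial>lborel)"
  proof (rule nn_integral_mono)
    fix z
    have "ennreal (A * (L2_norm h)\<^sup>2) = ennreal (A * (L2_norm (tf_shift z h))\<^sup>2)"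
      using h by (simp add: L2_tf_shift)
    also have "\<dots> \<le> (\<Sum>\<^sub>\<infinity>l\<in>?L. ennreal ((cmod (L2_inner (tf_shift z h) (tf_shift l g)))\<^sup>2))"
      using frame L2_tf_shift(1)[OF h] by (auto simp: lower_frame_bound_def)
    also have "\<dots> = (\<Sum>\<^sub>\<infinity>l\<in>?L. Q (z - l))"
      by (simp add: cmod_L2_inner_tf_shift_tf_shift Q_def)
    also have "\<dots> \<le> (\<integral>\<^sup>+l. Q (z - l) \<partial>count_space ?L)"
      by (rule infsum_ennreal_le_nn_integral_count_space)
    finally show "ennreal (A * (L2_norm h)\<^sup>2) * indicator C z
        \<le> (\<integral>\<^sup>+l. Q (z - l) * indicator C z \<partial>count_space ?L)"
      by (auto simp: indicator_def)
  qed
  also have "\<dots> = (\<integral>\<^sup>+l. (\<integral>\<^sup>+z. Q (z - l) * indicator C z \<partial>lborel) \<partial>count_space ?L)"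
    by (intro nn_integral_count_space_nn_integral countable_tf_lattice) measurable
  \<comment> \<open>Translation by \<open>l\<close> moves the lattice point from the coefficient to
    the box.\<close>
  also have "\<dots> = (\<integral>\<^sup>+l. (\<integral>\<^sup>+z. Q z * indicator C (z + l) \<partial>lborel) \<partial>count_space ?L)"
  proof (rule nn_integral_cong)
    fix l
    show "(\<integral>\<^sup>+z. Q (z - l) * indicator C z \<partial>lborel) = (\<integral>\<^sup>+z. Q z * indicator C (z + l) \<partial>lborel)"
      using nn_integral_lborel_translate[of "\<lambda>z. Q (z - l) * indicator C z" l] by simp
  qed
  also have "\<dots> = (\<integral>\<^sup>+z. (\<integral>\<^sup>+l. Q z * indicator C (z + l) \<partial>count_space ?L) \<partial>lborel)"
    by (intro nn_integral_count_space_nn_integral[symmetric] countable_tf_lattice) measurable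
  \<comment> \<open>By disjointness of the translated boxes, at most one lattice term survives for
    each \<open>z\<close>.\<close>
  also have "\<dots> \<le> (\<integral>\<^sup>+z. Q z \<partial>lborel)"
  proof (rule nn_integral_mono)
    fix z
    show "(\<integral>\<^sup>+l. Q z * indicator C (z + l) \<partial>count_space ?L) \<le> Q z"
    proof (cases "\<exists>l\<in>?L. z + l \<in> C")
      case True
      then obtain l where l: "l \<in> ?L" "z + l \<in> C" by auto
      have "(\<integral>\<^sup>+l. Q z * indicator C (z + l) \<partial>count_space ?L) = (\<Sum>l\<in>{l}. Q z * indicator C (z + l))"
      proof (rule nn_integral_count_space')
        fix l' assume l': "l' \<in> ?L" "l' \<notin> {l}"
        have "z + l' \<notin> C"
        proof
          assume "z + l' \<in> C"
          with l(2) have "l' = l"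
            unfolding C_def by (intro tf_lattice_translate_box_unique[OF ab l'(1) l(1)])
          with l' show False by simp
        qed
        then show "Q z * indicator C (z + l') = 0" by simp
      qed (use l in auto)
      with l show ?thesis by simp
    next
      case False
      then have "(\<integral>\<^sup>+l. Q z * indicator C (z + l) \<partial>count_space ?L) = (\<integral>\<^sup>+l. 0 \<partial>count_space ?L)"
        by (intro nn_integral_cong) (auto simp: indicator_def)
      then show ?thesis by simp
    qed
  qed
  finally show ?thesis unfolding Q_def .
qed

section \<open>Short-time Fourier transforms with Gaussian windows\<close>

definition gaussian :: "real \<Rightarrow> 'a::euclidean_space \<Rightarrow> real" where
  "gaussian c t = exp (- pi * c * (norm t)\<^sup>2)"

text \<open>For \<open>0 < c\<close> this is the Fourier transform of \<open>gaussian c\<close> in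
  closed form, with the kernel normalized by \<open>2 * pi\<close> in the exponent.\<close>

definition gaussian_hat :: "real \<Rightarrow> 'a::euclidean_space \<Rightarrow> real" where
  "gaussian_hat c w = exp (- pi * (norm w)\<^sup>2 / c) / sqrt c ^ DIM('a)"

lemma gaussian_pos: "0 < gaussian c t"
  by (simp add: gaussian_def)

lemma gaussian_hat_nonneg: "0 < c \<Longrightarrow> 0 \<le> gaussian_hat c t"
  by (simp add: gaussian_hat_def)

lemma gaussian_le_1: "0 \<le> c \<Longrightarrow> gaussian c t \<le> 1"
  by (simp add: gaussian_def)

lemma borel_measurable_gaussian [measurable]:
  "gaussian c \<in> borel_measurable borel" "gaussian_hat c \<in> borel_measurable borel"
  unfolding gaussian_def gaussian_hat_def by measurable

lemma gaussian_hat_eq_gaussian: "gaussian_hat c w = gaussian (1 / c) w / sqrt c ^ DIM('a)"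
  for w :: "'a::euclidean_space"
  by (simp add: gaussian_def gaussian_hat_def)

lemma gaussian_mult: "gaussian c t * gaussian d t = gaussian (c + d) t"
  by (simp add: gaussian_def algebra_simps flip: exp_add)

lemma has_bochner_integral_gaussian:
  assumes "0 < c"
  shows "has_bochner_integral lborel (gaussian c :: 'a::euclidean_space \<Rightarrow> real) (1 / sqrt c ^ DIM('a))"
proof -
  have "has_bochner_integral lborel (\<lambda>t::'a. complex_of_real (gaussian c t))
      (complex_of_real (1 / sqrt c ^ DIM('a)))"
    using has_bochner_integral_gaussian_cis[OF assms, of "0::'a"] by (simp add: gaussian_def)
  from has_bochner_integral_bounded_linear[OF bounded_linear_Re this] show ?thesis
    by simp
qed

lemma integrable_gaussian_hat:
  assumes "0 < c"
  shows "integrable lborel (gaussian_hat c :: 'a::euclidean_space \<Rightarrow> real)"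
  using has_bochner_integral_gaussian[of "1 / c", where 'a='a] assms
  by (simp add: gaussian_hat_eq_gaussian[abs_def] has_bochner_integral_iff)

text \<open>\<open>gaussian_hat c\<close> is a multiple of the Gaussian with parameter
  \<open>1 / c\<close>, so the explicit Fourier integral applies a second time.\<close>

lemma gaussian_inversion:
  fixes t :: "'a::euclidean_space"
  assumes "0 < c"
  shows "(\<integral>w. complex_of_real (gaussian_hat c w) * cis (2 * pi * (w \<bullet> t)) \<partial>lborel)
    = complex_of_real (gaussian c t)"
proof -
  have "(\<integral>w. complex_of_real (gaussian_hat c w) * cis (2 * pi * (w \<bullet> t)) \<partial>lborel)
    = (\<integral>w. (complex_of_real (exp (- pi * (1 / c) * (norm w)\<^sup>2)) * cis (2 * pi * (w \<bullet> t))) /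
        complex_of_real (sqrt c ^ DIM('a)) \<partial>lborel)"
    by (simp add: gaussian_hat_def)
  also have "\<dots> = complex_of_real (gaussian c t)"
    using has_bochner_integral_gaussian_cis[of "1 / c" t] assms
    by (subst integral_divide_zero)
       (simp add: has_bochner_integral_iff gaussian_def real_sqrt_divide power_divide mult.commute)
  finally show ?thesis .
qed

text \<open>The square is a multiple of the Gaussian with parameter \<open>2 / c\<close>. The value
  is the squared norm of \<open>gaussian c\<close>, as Plancherel's theorem predicts, and this
  agreement later makes the norm of the test function cancel.\<close>

lemma integral_gaussian_hat_sq:
  assumes "0 < c"
  shows "has_bochner_integral lborel (\<lambda>w::'a::euclidean_space. (gaussian_hat c w)\<^sup>2)
    (1 / sqrt (2 * c) ^ DIM('a))"
proof -
  have "(gaussian_hat c w)\<^sup>2 = gaussian (2 / c) w / c ^ DIM('a)" for w :: 'a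
    using assms unfolding gaussian_hat_eq_gaussian
    by (simp add: power_divide power2_eq_square gaussian_mult flip: power_mult_distrib)
  moreover have "has_bochner_integral lborel (\<lambda>w::'a. gaussian (2 / c) w / c ^ DIM('a))
      (1 / sqrt (2 / c) ^ DIM('a) / c ^ DIM('a))"
    using assms by (intro has_bochner_integral_divide_zero has_bochner_integral_gaussian) simp
  moreover have "sqrt (2 / c) * c = sqrt (2 * c)"
    using assms by (simp add: real_sqrt_divide real_sqrt_mult field_simps)
  ultimately show ?thesis
    by (simp flip: power_mult_distrib)
qed

lemma L2_gaussian:
  assumes "0 < c"
  shows "(\<lambda>t::real ^ 'd. complex_of_real (gaussian c t)) \<in> L2"
    and "(L2_norm (\<lambda>t::real ^ 'd. complex_of_real (gaussian c t)))\<^sup>2 = 1 / sqrt (2 * c) ^ CARD('d)"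
proof -
  have sq: "(gaussian c t)\<^sup>2 = gaussian (2 * c) t" for t :: "real ^ 'd"
    by (simp add: power2_eq_square gaussian_mult)
  have "has_bochner_integral lborel (\<lambda>t::real ^ 'd. (gaussian c t)\<^sup>2) (1 / sqrt (2 * c) ^ CARD('d))"
    unfolding sq using has_bochner_integral_gaussian[of "2 * c", where 'a="real ^ 'd"] assms by simp
  then show "(\<lambda>t::real ^ 'd. complex_of_real (gaussian c t)) \<in> L2"
    "(L2_norm (\<lambda>t::real ^ 'd. complex_of_real (gaussian c t)))\<^sup>2 = 1 / sqrt (2 * c) ^ CARD('d)"
    unfolding L2_norm_sq by (simp_all add: L2_def has_bochner_integral_iff)
qed

text \<open>Fubini's theorem interchanges the integrals, and the triangle inequality is then applied
  to the outer one only, so that cancellation in \<open>t\<close> is kept.\<close>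

lemma cmod_integral_integral_le:
  fixes F :: "'a::euclidean_space \<Rightarrow> 'b::euclidean_space \<Rightarrow> complex"
  assumes "integrable (lborel \<Otimes>\<^sub>M lborel) (\<lambda>(t, p). F t p)"
  shows "ennreal (cmod (\<integral>t. (\<integral>p. F t p \<partial>lborel) \<partial>lborel))
    \<le> (\<integral>\<^sup>+p. ennreal (cmod (\<integral>t. F t p \<partial>lborel)) \<partial>lborel)"
proof -
  have "integrable lborel (\<lambda>p. \<integral>t. F t p \<partial>lborel)"
    using lborel_pair.integrable_snd[OF assms] by simp
  from integral_norm_bound_ennreal[OF this] show ?thesis
    using lborel_pair.Fubini_integral[OF assms] by simp
qed

lemma integrable_pair_product:
  fixes f :: "'a::euclidean_space \<Rightarrow> complex" and k :: "'b::euclidean_space \<Rightarrow> real"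
  assumes f: "integrable lborel f" and k: "integrable lborel k"
    and F: "(\<lambda>(t, p). F t p) \<in> borel_measurable (lborel \<Otimes>\<^sub>M lborel)"
    and le: "\<And>t p. cmod (F t p) \<le> cmod (f t) * \<bar>k p\<bar>"
  shows "integrable (lborel \<Otimes>\<^sub>M lborel) (\<lambda>(t, p). F t p)"
proof (rule integrableI_bounded[OF F])
  note [measurable] = borel_measurable_integrable[OF f] borel_measurable_integrable[OF k]
  have "(\<integral>\<^sup>+x. ennreal (norm (case x of (t, p) \<Rightarrow> F t p)) \<partial>(lborel \<Otimes>\<^sub>M lborel))
      \<le> (\<integral>\<^sup>+x. ennreal (cmod (f (fst x))) * ennreal (norm (k (snd x))) \<partial>(lborel \<Otimes>\<^sub>M lborel))"
    by (intro nn_integral_mono) (auto simp: le simp flip: ennreal_mult)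
  also have "\<dots> = (\<integral>\<^sup>+t. (\<integral>\<^sup>+p. ennreal (cmod (f t)) * ennreal (norm (k p)) \<partial>lborel) \<partial>lborel)"
    by (subst lborel.nn_integral_fst[symmetric]) auto
  also have "\<dots> = (\<integral>\<^sup>+t. ennreal (cmod (f t)) \<partial>lborel) * (\<integral>\<^sup>+p. ennreal (norm (k p)) \<partial>lborel)"
    by (simp add: nn_integral_cmult nn_integral_multc)
  also have "\<dots> < \<infinity>"
    using f k by (auto simp: integrable_iff_bounded ennreal_mult_less_top)
  finally show "(\<integral>\<^sup>+x. ennreal (norm (case x of (t, p) \<Rightarrow> F t p)) \<partial>(lborel \<Otimes>\<^sub>M lborel)) < \<infinity>" .
qed

text \<open>Multiplication by a Gaussian is an average over frequency shifts, by Fourier inversion.\<close>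

lemma cmod_integral_gaussian_mult_le:
  fixes u :: "'a::euclidean_space \<Rightarrow> complex"
  assumes u: "integrable lborel u" and c: "0 < c"
  shows "ennreal (cmod (\<integral>t. u t * cis (- (2 * pi * (t \<bullet> w))) * gaussian c (t - x) \<partial>lborel))
    \<le> (\<integral>\<^sup>+p. ennreal (gaussian_hat c p) *
        ennreal (cmod (\<integral>t. u t * cis (- (2 * pi * (t \<bullet> (w - p)))) \<partial>lborel)) \<partial>lborel)"
proof -
  note [measurable] = borel_measurable_integrable[OF u, simplified]
  define F where "F t p = u t * cis (- (2 * pi * (t \<bullet> w))) *
      (complex_of_real (gaussian_hat c p) * cis (2 * pi * (p \<bullet> (t - x))))" for t p
  \<comment> \<open>The position \<open>x\<close> enters only through a unimodular factor, which the
    modulus removes.\<close>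
  have F: "F t p = complex_of_real (gaussian_hat c p) * cis (- (2 * pi * (p \<bullet> x))) *
      (u t * cis (- (2 * pi * (t \<bullet> (w - p)))))" for t p
  proof -
    have "cis (- (2 * pi * (t \<bullet> w))) * cis (2 * pi * (p \<bullet> (t - x))) =
        cis (- (2 * pi * (p \<bullet> x))) * cis (- (2 * pi * (t \<bullet> (w - p))))"
      by (simp add: cis_mult inner_simps inner_commute algebra_simps)
    then show ?thesis by (simp add: F_def mult_ac) 
  qed
  have "integrable (lborel \<Otimes>\<^sub>M lborel) (\<lambda>(t, p). F t p)"
    by (rule integrable_pair_product[OF u integrable_gaussian_hat[OF c]])
       (auto simp: F_def norm_mult)
  then have "ennreal (cmod (\<integral>t. (\<integral>p. F t p \<partial>lborel) \<partial>lborel))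
      \<le> (\<integral>\<^sup>+p. ennreal (cmod (\<integral>t. F t p \<partial>lborel)) \<partial>lborel)"
    by (rule cmod_integral_integral_le)
  also have "(\<lambda>t. \<integral>p. F t p \<partial>lborel) =
      (\<lambda>t. u t * cis (- (2 * pi * (t \<bullet> w))) * gaussian c (t - x))"
    unfolding F_def by (simp only: integral_mult_right_zero gaussian_inversion[OF c])
  also have "(\<integral>\<^sup>+p. ennreal (cmod (\<integral>t. F t p \<partial>lborel)) \<partial>lborel) =
      (\<integral>\<^sup>+p. ennreal (gaussian_hat c p) *
        ennreal (cmod (\<integral>t. u t * cis (- (2 * pi * (t \<bullet> (w - p)))) \<partial>lborel)) \<partial>lborel)"
    unfolding F integral_mult_right_zero
    using gaussian_hat_nonneg[OF c, where 'a='a] by (simp add: norm_mult ennreal_mult abs_of_nonneg)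
  finally show ?thesis .
qed

text \<open>The windows \<open>gaussian 1 (t - y)\<close> integrate to 1 over \<open>y\<close>, so
  inserting them leaves the Fourier integral unchanged. This controls the Fourier transform by the
  Gaussian short-time Fourier transform, and hence by the data of the
  \<open>S0_norm\<close>.\<close>

lemma cmod_fourier_le_nn_integral_window:
  fixes u :: "'a::euclidean_space \<Rightarrow> complex"
  assumes u: "integrable lborel u"
  shows "ennreal (cmod (\<integral>t. u t * cis (- (2 * pi * (t \<bullet> w))) \<partial>lborel))
    \<le> (\<integral>\<^sup>+y. ennreal (cmod (\<integral>t. u t * cis (- (2 * pi * (t \<bullet> w))) * gaussian 1 (t - y) \<partial>lborel)) \<partial>lborel)"
proof -
  note [measurable] = borel_measurable_integrable[OF u, simplified]
  let ?F = "\<lambda>t y. u t * cis (- (2 * pi * (t \<bullet> w))) * complex_of_real (gaussian 1 (t - y))"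
  have g1: "(\<integral>\<^sup>+y. ennreal (gaussian 1 (t - y)) \<partial>lborel) = 1" for t :: 'a
  proof -
    have "(\<integral>\<^sup>+y. ennreal (gaussian 1 (t - y)) \<partial>lborel) = (\<integral>\<^sup>+y. ennreal (gaussian 1 (y::'a)) \<partial>lborel)"
      by (rule nn_integral_lborel_reflect) measurable
    also have "\<dots> = 1"
      using has_bochner_integral_gaussian[of 1, where 'a='a]
      by (subst nn_integral_eq_integral) (auto simp: has_bochner_integral_iff less_imp_le gaussian_pos)
    finally show ?thesis .
  qed
  have g2: "(\<integral>y. complex_of_real (gaussian 1 (t - y)) \<partial>lborel) = 1" for t :: 'a
  proof -
    have "has_bochner_integral lborel (\<lambda>y. gaussian 1 (t - y)) 1"
      using g1[of t] by (intro has_bochner_integral_nn_integral) (auto simp: less_imp_le gaussian_pos)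
    then show ?thesis by (simp add: has_bochner_integral_iff)
  qed
  have "integrable (lborel \<Otimes>\<^sub>M lborel) (\<lambda>(t, y). ?F t y)"
  proof (rule integrableI_bounded)
    have "(\<integral>\<^sup>+x. ennreal (norm (case x of (t, y) \<Rightarrow> ?F t y)) \<partial>(lborel \<Otimes>\<^sub>M lborel))
        = (\<integral>\<^sup>+t. (\<integral>\<^sup>+y. ennreal (cmod (u t)) * ennreal (gaussian 1 (t - y)) \<partial>lborel) \<partial>lborel)"
      by (subst lborel.nn_integral_fst[symmetric])
         (auto simp: norm_mult ennreal_mult less_imp_le gaussian_pos)
    also have "\<dots> = (\<integral>\<^sup>+t. ennreal (cmod (u t)) \<partial>lborel)"
      by (simp add: nn_integral_cmult g1)
    also have "\<dots> < \<infinity>"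
      using u by (simp add: integrable_iff_bounded)
    finally show "(\<integral>\<^sup>+x. ennreal (norm (case x of (t, y) \<Rightarrow> ?F t y)) \<partial>(lborel \<Otimes>\<^sub>M lborel)) < \<infinity>" .
  qed measurable
  from cmod_integral_integral_le[OF this] show ?thesis
    by (simp only: integral_mult_right_zero g2 mult_1_right)
qed

text \<open>Young's inequality for an L2 function convolved with an L1 function. Cauchy-Schwarz
  against the constant 1, for the measure with density \<open>W\<close>, produces one factor of the
  total mass; Tonelli and translation invariance produce the other.\<close>

lemma nn_integral_convolution_sq_le:
  fixes k W :: "'a::euclidean_space \<Rightarrow> ennreal"
  assumes [measurable]: "k \<in> borel_measurable borel" "W \<in> borel_measurable borel"
  shows "(\<integral>\<^sup>+w. (\<integral>\<^sup>+p. k p * W (w - p) \<partial>lborel)\<^sup>2 \<partial>lborel)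
    \<le> (\<integral>\<^sup>+p. (k p)\<^sup>2 \<partial>lborel) * (\<integral>\<^sup>+p. W p \<partial>lborel)\<^sup>2"
proof -
  let ?S = "\<integral>\<^sup>+p. W p \<partial>lborel" and ?D = "density lborel W"
  have "(\<integral>\<^sup>+w. (\<integral>\<^sup>+p. k p * W (w - p) \<partial>lborel)\<^sup>2 \<partial>lborel)
      = (\<integral>\<^sup>+w. (\<integral>\<^sup>+q. k (w - q) * 1 \<partial>?D)\<^sup>2 \<partial>lborel)"
  proof (rule nn_integral_cong)
    fix w
    have "(\<integral>\<^sup>+p. k p * W (w - p) \<partial>lborel) = (\<integral>\<^sup>+q. k (w - q) * W (w - (w - q)) \<partial>lborel)"
      by (rule nn_integral_lborel_reflect[symmetric]) measurable
    then show "(\<integral>\<^sup>+p. k p * W (w - p) \<partial>lborel)\<^sup>2 = (\<integral>\<^sup>+q. k (w - q) * 1 \<partial>?D)\<^sup>2"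
      by (simp add: nn_integral_density mult.commute)
  qed
  also have "\<dots> \<le> (\<integral>\<^sup>+w. (\<integral>\<^sup>+q. (k (w - q))\<^sup>2 \<partial>?D) * (\<integral>\<^sup>+q. 1\<^sup>2 \<partial>?D) \<partial>lborel)"
    by (intro nn_integral_mono Cauchy_Schwarz_nn_integral) auto
  also have "\<dots> = (\<integral>\<^sup>+w. (\<integral>\<^sup>+q. W q * (k (w - q))\<^sup>2 \<partial>lborel) * ?S \<partial>lborel)"
  proof -
    have "(\<integral>\<^sup>+q. 1\<^sup>2 \<partial>?D) = ?S"
      by (subst nn_integral_density) auto
    then show ?thesis by (simp only:) (simp add: nn_integral_density)
  qed
  also have "\<dots> = (\<integral>\<^sup>+w. (\<integral>\<^sup>+q. W q * (k (w - q))\<^sup>2 \<partial>lborel) \<partial>lborel) * ?S"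
    by (rule nn_integral_multc) measurable
  also have "(\<integral>\<^sup>+w. (\<integral>\<^sup>+q. W q * (k (w - q))\<^sup>2 \<partial>lborel) \<partial>lborel)
      = (\<integral>\<^sup>+q. (\<integral>\<^sup>+w. W q * (k (w - q))\<^sup>2 \<partial>lborel) \<partial>lborel)"
    by (rule lborel_pair.Fubini'[symmetric]) measurable
  also have "\<dots> = (\<integral>\<^sup>+q. W q * (\<integral>\<^sup>+p. (k p)\<^sup>2 \<partial>lborel) \<partial>lborel)"
  proof (rule nn_integral_cong)
    fix q
    show "(\<integral>\<^sup>+w. W q * (k (w - q))\<^sup>2 \<partial>lborel) = W q * (\<integral>\<^sup>+p. (k p)\<^sup>2 \<partial>lborel)"
      using nn_integral_lborel_translate[of "\<lambda>p. (k p)\<^sup>2" "- q"] by (simp add: nn_integral_cmult)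
  qed
  also have "\<dots> = (\<integral>\<^sup>+p. (k p)\<^sup>2 \<partial>lborel) * ?S"
    by (simp add: nn_integral_multc mult.commute)
  finally show ?thesis
    by (simp add: power2_eq_square mult.assoc)
qed

text \<open>Lowering the parameter decreases the exponential, so only the normalizing denominators
  cost a factor, and that factor tends to 1 as \<open>c\<close> grows.\<close>

lemma gaussian_hat_minus_1_le:
  fixes w :: "'a::euclidean_space"
  assumes "1 < c"
  shows "gaussian_hat (c - 1) w \<le> sqrt (c / (c - 1)) ^ DIM('a) * gaussian_hat c w"
proof -
  have "- pi * (norm w)\<^sup>2 / (c - 1) \<le> - pi * (norm w)\<^sup>2 / c"
    using assms by (simp add: frac_le)
  then have "gaussian_hat (c - 1) w \<le> exp (- pi * (norm w)\<^sup>2 / c) / sqrt (c - 1) ^ DIM('a)"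
    unfolding gaussian_hat_def using assms by (intro divide_right_mono) auto
  also have "\<dots> = sqrt (c / (c - 1)) ^ DIM('a) * gaussian_hat c w"
    using assms by (simp add: gaussian_hat_def real_sqrt_divide power_divide)
  finally show ?thesis .
qed

text \<open>
  One factor of the square is estimated at the fixed position \<open>x\<close>, splitting the narrow Gaussian
  as \<^term>\<open>gaussian 1 t * gaussian (c - 1) t\<close>; the other one is estimated through the Fourier
  transform of \<open>g\<close>, which is the integral of the Gaussian short-time Fourier transform over all
  positions. No constant is lost as \<open>c\<close> tends to infinity.
\<close>

lemma nn_integral_L2_inner_gaussian_sq_le:
  fixes g :: "real ^ 'd \<Rightarrow> complex"
  assumes g: "integrable lborel g" and c: "1 < c"
  shows "(\<integral>\<^sup>+z. ennreal ((cmod (L2_inner g (tf_shift z (\<lambda>t. complex_of_real (gaussian c t)))))\<^sup>2) \<partial>lborel)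
    \<le> ennreal (sqrt (c / (c - 1)) ^ CARD('d) / sqrt (2 * c) ^ CARD('d)) * (S0_norm g)\<^sup>2"
proof -
  note [measurable] = borel_measurable_integrable[OF g, simplified]
  define V where "V e x w = ennreal (cmod (\<integral>t. g t * cis (- (2 * pi * (t \<bullet> w))) *
      complex_of_real (gaussian e (t - x)) \<partial>lborel))" for e and x w :: "real ^ 'd"
  have V_eq: "V e (fst z) (snd z) =
      ennreal (cmod (L2_inner g (tf_shift z (\<lambda>t. complex_of_real (gaussian e t)))))" for e z
    unfolding V_def L2_inner_def tf_shift_def by (simp add: cis_cnj mult.assoc)
  have V_pair: "case_prod (V e) =
      (\<lambda>z. ennreal (cmod (L2_inner g (tf_shift z (\<lambda>t. complex_of_real (gaussian e t))))))" for e
    by (auto simp: V_eq simp flip: V_eq)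
  have [measurable]: "case_prod (V e) \<in> borel_measurable (borel \<Otimes>\<^sub>M borel)" for e
    unfolding V_pair borel_prod
    using borel_measurable_L2_inner_tf_shift[of g "\<lambda>t. complex_of_real (gaussian e t)"]
    by measurable
  \<comment> \<open>The price of replacing \<open>gaussian_hat (c - 1)\<close> by
    \<open>gaussian_hat c\<close>.\<close>
  define C where "C = sqrt (c / (c - 1)) ^ CARD('d)"
  define k where "k p = ennreal (gaussian_hat c p)" for p :: "real ^ 'd"
  \<comment> \<open>\<open>W\<close> collects the Gaussian short-time Fourier transform over all
    positions, so its integral is the \<open>S0_norm\<close>. The convolution \<open>N\<close> of
    \<open>k\<close> and \<open>W\<close> will bound the transform with the narrow window uniformly
    in position.\<close>
  define W where "W w = (\<integral>\<^sup>+y. V 1 y w \<partial>lborel)" for w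
  define N where "N w = (\<integral>\<^sup>+p. k p * W (w - p) \<partial>lborel)" for w
  have [measurable]: "k \<in> borel_measurable borel"
    unfolding k_def by measurable
  have [measurable]: "W \<in> borel_measurable borel"
    unfolding W_def by measurable
  have [measurable]: "N \<in> borel_measurable borel"
    unfolding N_def by measurable
  have "0 \<le> C" unfolding C_def using c by simp
  have S: "S0_norm g = (\<integral>\<^sup>+w. W w \<partial>lborel)"
  proof -
    have "S0_norm g = (\<integral>\<^sup>+z. case_prod (V 1) z \<partial>lborel)"
      unfolding S0_norm_def V_pair gauss_def gaussian_def by simp
    also have "\<dots> = (\<integral>\<^sup>+w. W w \<partial>lborel)"
      unfolding W_def lborel_prod[symmetric]
      by (subst lborel_pair.nn_integral_snd[symmetric]) auto
    finally show ?thesis .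
  qed
  have bound1: "V c x w \<le> ennreal C * (\<integral>\<^sup>+p. k p * V 1 x (w - p) \<partial>lborel)" for x w
  proof -
    \<comment> \<open>The wide factor \<open>gaussian 1\<close> of the window is absorbed into the
      function, which leaves the narrow factor \<open>gaussian (c - 1)\<close> to be expanded into
      frequencies.\<close>
    let ?u = "\<lambda>t. g t * complex_of_real (gaussian 1 (t - x))"
    have "integrable lborel ?u"
    proof (rule Bochner_Integration.integrable_bound[OF g])
      show "AE t in lborel. norm (?u t) \<le> norm (g t)"
        by (simp add: norm_mult abs_of_pos[OF gaussian_pos] mult_left_le gaussian_le_1)
    qed measurable
    moreover have "V c x w =
        ennreal (cmod (\<integral>t. ?u t * cis (- (2 * pi * (t \<bullet> w))) * gaussian (c - 1) (t - x) \<partial>lborel))"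
    proof -
      have "complex_of_real (gaussian c s) = complex_of_real (gaussian 1 s) * complex_of_real (gaussian (c - 1) s)"
        for s :: "real ^ 'd"
        by (simp add: gaussian_mult flip: of_real_mult)
      then show ?thesis unfolding V_def by (simp only: mult_ac)
    qed
    ultimately have "V c x w \<le> (\<integral>\<^sup>+p. ennreal (gaussian_hat (c - 1) p) *
        ennreal (cmod (\<integral>t. ?u t * cis (- (2 * pi * (t \<bullet> (w - p)))) \<partial>lborel)) \<partial>lborel)"
      using cmod_integral_gaussian_mult_le[of ?u "c - 1" w x] c by simp
    also have "\<dots> = (\<integral>\<^sup>+p. ennreal (gaussian_hat (c - 1) p) * V 1 x (w - p) \<partial>lborel)"
      unfolding V_def by (simp only: mult_ac)
    also have "\<dots> \<le> (\<integral>\<^sup>+p. ennreal C * (k p * V 1 x (w - p)) \<partial>lborel)"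
    proof (rule nn_integral_mono)
      fix p :: "real ^ 'd"
      have "ennreal (gaussian_hat (c - 1) p) \<le> ennreal C * k p"
        unfolding k_def C_def using gaussian_hat_minus_1_le[OF c, of p] c
        by (simp add: ennreal_leI flip: ennreal_mult')
      then show "ennreal (gaussian_hat (c - 1) p) * V 1 x (w - p) \<le> ennreal C * (k p * V 1 x (w - p))"
        by (metis mult.assoc mult_right_mono zero_le)
    qed
    also have "\<dots> = ennreal C * (\<integral>\<^sup>+p. k p * V 1 x (w - p) \<partial>lborel)"
      by (rule nn_integral_cmult) measurable
    finally show ?thesis .
  qed
  have bound2: "V c x w \<le> N w" for x w
  proof -
    have "V c x w \<le> (\<integral>\<^sup>+p. k p *
        ennreal (cmod (\<integral>t. g t * cis (- (2 * pi * (t \<bullet> (w - p)))) \<partial>lborel)) \<partial>lborel)"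
      unfolding V_def k_def using cmod_integral_gaussian_mult_le[OF g, of c w x] c by simp
    also have "\<dots> \<le> N w"
      unfolding N_def W_def V_def
      by (intro nn_integral_mono mult_left_mono cmod_fourier_le_nn_integral_window[OF g]) simp
    finally show ?thesis .
  qed
  have "(\<integral>\<^sup>+z. ennreal ((cmod (L2_inner g (tf_shift z (\<lambda>t. complex_of_real (gaussian c t)))))\<^sup>2) \<partial>lborel)
      = (\<integral>\<^sup>+z. (case_prod (V c) z)\<^sup>2 \<partial>lborel)"
    unfolding V_pair by (simp add: ennreal_power)
  also have "\<dots> = (\<integral>\<^sup>+w. (\<integral>\<^sup>+x. (V c x w)\<^sup>2 \<partial>lborel) \<partial>lborel)"
    unfolding lborel_prod[symmetric]
    by (subst lborel_pair.nn_integral_snd[symmetric]) auto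
  \<comment> \<open>One factor is bounded by \<open>bound1\<close>, which keeps the position, and
    the other by \<open>bound2\<close>, which does not depend on it. The integral over
    \<open>x\<close> therefore acts on a single factor and turns \<open>V 1\<close> into
    \<open>W\<close>, which gives a second \<open>N\<close>.\<close>
  also have "\<dots> \<le> (\<integral>\<^sup>+w. (\<integral>\<^sup>+x. ennreal C * (\<integral>\<^sup>+p. k p * V 1 x (w - p) \<partial>lborel) * N w \<partial>lborel) \<partial>lborel)"
    unfolding power2_eq_square by (intro nn_integral_mono mult_mono bound1 bound2) auto
  also have "\<dots> = (\<integral>\<^sup>+w. ennreal C * (N w)\<^sup>2 \<partial>lborel)"
  proof (rule nn_integral_cong)
    fix w
    have "(\<integral>\<^sup>+x. ennreal C * (\<integral>\<^sup>+p. k p * V 1 x (w - p) \<partial>lborel) * N w \<partial>lborel)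
        = ennreal C * (\<integral>\<^sup>+x. (\<integral>\<^sup>+p. k p * V 1 x (w - p) \<partial>lborel) \<partial>lborel) * N w"
      by (subst nn_integral_multc, measurable) (subst nn_integral_cmult, measurable)
    also have "(\<integral>\<^sup>+x. (\<integral>\<^sup>+p. k p * V 1 x (w - p) \<partial>lborel) \<partial>lborel)
        = (\<integral>\<^sup>+p. (\<integral>\<^sup>+x. k p * V 1 x (w - p) \<partial>lborel) \<partial>lborel)"
      by (rule lborel_pair.Fubini'[symmetric]) measurable
    also have "\<dots> = N w"
      unfolding N_def W_def by (intro nn_integral_cong nn_integral_cmult) measurable
    finally show "(\<integral>\<^sup>+x. ennreal C * (\<integral>\<^sup>+p. k p * V 1 x (w - p) \<partial>lborel) * N w \<partial>lborel)
        = ennreal C * (N w)\<^sup>2"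
      by (simp add: power2_eq_square mult.assoc)
  qed
  also have "\<dots> = ennreal C * (\<integral>\<^sup>+w. (N w)\<^sup>2 \<partial>lborel)"
    by (rule nn_integral_cmult) measurable
  also have "\<dots> \<le> ennreal C * ((\<integral>\<^sup>+p. (k p)\<^sup>2 \<partial>lborel) * (\<integral>\<^sup>+w. W w \<partial>lborel)\<^sup>2)"
    unfolding N_def by (intro mult_left_mono nn_integral_convolution_sq_le) auto
  also have "(\<integral>\<^sup>+p. (k p)\<^sup>2 \<partial>lborel) = ennreal (1 / sqrt (2 * c) ^ CARD('d))"
    using integral_gaussian_hat_sq[of c, where 'a="real ^ 'd"] c gaussian_hat_nonneg[of c, where 'a="real ^ 'd"]
    by (simp add: k_def ennreal_power has_bochner_integral_iff nn_integral_eq_integral)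
  also have "ennreal C * (ennreal (1 / sqrt (2 * c) ^ CARD('d)) * (\<integral>\<^sup>+w. W w \<partial>lborel)\<^sup>2)
      = ennreal (C / sqrt (2 * c) ^ CARD('d)) * (S0_norm g)\<^sup>2"
    unfolding S using \<open>0 \<le> C\<close> by (simp add: ennreal_mult'[symmetric] mult.assoc[symmetric])
  finally show ?thesis unfolding C_def .
qed

text \<open>On the compact set the modulus of \<open>g\<close> is at most
  \<open>1 + (cmod (g t))\<^sup>2\<close>, and almost everywhere outside it \<open>g\<close>
  vanishes.\<close>

lemma integrable_if_compactly_supported_L2:
  fixes g :: "real ^ 'd \<Rightarrow> complex"
  assumes g: "g \<in> L2" and supp: "compactly_supported g"
  shows "integrable lborel g"
proof -
  note [measurable] = L2_borel_measurable[OF g]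
  obtain K where K: "compact K" "AE t in lborel. t \<notin> K \<longrightarrow> g t = 0"
    using supp by (auto simp: compactly_supported_def)
  have "integrable lborel (\<lambda>t. indicator K t + (cmod (g t))\<^sup>2)"
    using g emeasure_compact_finite[OF K(1)] K(1)
    by (intro Bochner_Integration.integrable_add) (auto simp: L2_def borel_compact)
  moreover have "AE t in lborel. norm (g t) \<le> norm (indicator K t + (cmod (g t))\<^sup>2)"
    using K(2)
  proof eventually_elim
    case (elim t)
    have "0 \<le> (cmod (g t) - 1)\<^sup>2" by simp
    then have "2 * cmod (g t) \<le> 1 + (cmod (g t))\<^sup>2" by (simp add: power2_diff)
    then have "cmod (g t) \<le> 1 + (cmod (g t))\<^sup>2"
      using norm_ge_zero[of "g t"] by linarith
    with elim show ?case by (cases "t \<in> K") auto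
  qed
  moreover have "g \<in> borel_measurable lborel" by measurable
  ultimately show ?thesis
    using Bochner_Integration.integrable_bound by blast
qed

text \<open>The averaged frame inequality is tested on \<open>gaussian c\<close>. Its squared norm
  cancels from both sides, and the remaining constant disappears in the limit of large
  \<open>c\<close>.\<close>

lemma lower_frame_bound_le_S0_norm:
  fixes g :: "real ^ 'd \<Rightarrow> complex"
  assumes ab: "0 < a" "0 < b"
    and frame: "lower_frame_bound (tf_lattice a b) (\<lambda>z. tf_shift z g) A"
    and g: "g \<in> L2" "compactly_supported g" and S: "S0_norm g \<le> ennreal s" "0 \<le> s"
  shows "A * (a * b) ^ CARD('d) \<le> s\<^sup>2"
proof -
  have bound: "A * (a * b) ^ CARD('d) \<le> sqrt (c / (c - 1)) ^ CARD('d) * s\<^sup>2" if c: "1 < c" for c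
  proof -
    let ?h = "\<lambda>t::real ^ 'd. complex_of_real (gaussian c t)"
    \<comment> \<open>The squared norm of the test Gaussian; the upper estimate carries the same
      factor.\<close>
    define n where "n = 1 / sqrt (2 * c) ^ CARD('d)"
    have n: "0 < n" "(L2_norm ?h)\<^sup>2 = n" unfolding n_def using c L2_gaussian(2)[of c] by auto
    have "ennreal (A * n * (a * b) ^ CARD('d))
        \<le> (\<integral>\<^sup>+z. ennreal ((cmod (L2_inner g (tf_shift z ?h)))\<^sup>2) \<partial>lborel)"
      using lower_frame_bound_average[OF ab frame g(1) L2_gaussian(1)[of c]] c n(2) by simp
    also have "\<dots> \<le> ennreal (sqrt (c / (c - 1)) ^ CARD('d) * n) * (S0_norm g)\<^sup>2"
      using nn_integral_L2_inner_gaussian_sq_le[OF integrable_if_compactly_supported_L2[OF g] c]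
      by (simp add: n_def)
    also have "\<dots> \<le> ennreal (sqrt (c / (c - 1)) ^ CARD('d) * n) * (ennreal s)\<^sup>2"
      by (intro mult_left_mono power_mono S) auto
    also have "\<dots> = ennreal (sqrt (c / (c - 1)) ^ CARD('d) * n * s\<^sup>2)"
      using S n c by (simp add: ennreal_power ennreal_mult')
    finally have "A * n * (a * b) ^ CARD('d) \<le> sqrt (c / (c - 1)) ^ CARD('d) * n * s\<^sup>2"
      using n c by (subst (asm) ennreal_le_iff) auto
    then have "n * (A * (a * b) ^ CARD('d)) \<le> n * (sqrt (c / (c - 1)) ^ CARD('d) * s\<^sup>2)"
      by (simp only: mult_ac)
    then show ?thesis using n(1) by (simp only: mult_le_cancel_left_pos)
  qed
  have "((\<lambda>c::real. c / (c - 1)) \<longlongrightarrow> 1) at_top"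
    by real_asymp
  then have "((\<lambda>c. sqrt (c / (c - 1)) ^ CARD('d) * s\<^sup>2) \<longlongrightarrow> sqrt 1 ^ CARD('d) * s\<^sup>2) at_top"
    by (intro tendsto_intros)
  then have "A * (a * b) ^ CARD('d) \<le> sqrt 1 ^ CARD('d) * s\<^sup>2"
  proof (rule tendsto_lowerbound)
    show "\<forall>\<^sub>F c in at_top. A * (a * b) ^ CARD('d) \<le> sqrt (c / (c - 1)) ^ CARD('d) * s\<^sup>2"
      using eventually_gt_at_top[of 1] by eventually_elim (rule bound)
  qed simp
  then show ?thesis by simp
qed

section \<open>Restriction of frames to subfamilies\<close>

text \<open>Tonelli's theorem for counting measures. The outer sum stays an integral, ready to be
  interchanged with an integral over space.\<close>

lemma infsum_Sigma_ennreal: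
  fixes f :: "'a \<times> 'b \<Rightarrow> ennreal"
  assumes A: "countable A" and B: "\<And>x. x \<in> A \<Longrightarrow> countable (B x)"
  shows "(\<Sum>\<^sub>\<infinity>p\<in>Sigma A B. f p) = (\<integral>\<^sup>+x. (\<Sum>\<^sub>\<infinity>y\<in>B x. f (x, y)) \<partial>count_space A)"
proof -
  have "(\<Sum>\<^sub>\<infinity>p\<in>Sigma A B. f p) = (\<integral>\<^sup>+p. f p * indicator (Sigma A B) p \<partial>count_space UNIV)"
    using A B
    by (simp add: infsum_ennreal_eq_nn_integral_count_space countable_SIGMA
        nn_integral_count_space_indicator)
  also have "\<dots> = (\<integral>\<^sup>+x. (\<integral>\<^sup>+y. f (x, y) * indicator (Sigma A B) (x, y) \<partial>count_space UNIV) \<partial>count_space UNIV)"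
    by (rule nn_integral_fst_count_space[symmetric])
  also have "\<dots> = (\<integral>\<^sup>+x. (\<integral>\<^sup>+y. f (x, y) * indicator (Sigma A B) (x, y) \<partial>count_space UNIV) \<partial>count_space A)"
    by (subst (2) nn_integral_count_space_indicator) (auto intro!: nn_integral_cong simp: indicator_def)
  also have "\<dots> = (\<integral>\<^sup>+x. (\<Sum>\<^sub>\<infinity>y\<in>B x. f (x, y)) \<partial>count_space A)"
  proof (rule nn_integral_cong)
    fix x assume "x \<in> space (count_space A)"
    then have "x \<in> A" by simp
    then show "(\<integral>\<^sup>+y. f (x, y) * indicator (Sigma A B) (x, y) \<partial>count_space UNIV) = (\<Sum>\<^sub>\<infinity>y\<in>B x. f (x, y))"
      using B by (simp add: infsum_ennreal_eq_nn_integral_count_space nn_integral_count_space_indicator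
          indicator_def)
  qed
  finally show ?thesis .
qed

lemma L2_mult_indicator:
  fixes f :: "real ^ 'd \<Rightarrow> complex"
  assumes f: "f \<in> L2" and [measurable]: "B \<in> sets borel"
  shows "(\<lambda>t. f t * indicator B t) \<in> L2"
    and "ennreal ((L2_norm (\<lambda>t. f t * indicator B t))\<^sup>2) =
      (\<integral>\<^sup>+t. ennreal ((cmod (f t))\<^sup>2) * indicator B t \<partial>lborel)"
proof -
  note [measurable] = L2_borel_measurable[OF f]
  have "integrable lborel (\<lambda>t. (cmod (f t * indicator B t))\<^sup>2)"
  proof (rule Bochner_Integration.integrable_bound)
    show "integrable lborel (\<lambda>t. (cmod (f t))\<^sup>2)"
      using f by (simp add: L2_def)
    show "AE t in lborel. norm ((cmod (f t * indicator B t))\<^sup>2) \<le> norm ((cmod (f t))\<^sup>2)"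
      by (simp add: indicator_def)
  qed measurable
  then show L2: "(\<lambda>t. f t * indicator B t) \<in> L2"
    by (simp add: L2_def)
  show "ennreal ((L2_norm (\<lambda>t. f t * indicator B t))\<^sup>2) =
      (\<integral>\<^sup>+t. ennreal ((cmod (f t))\<^sup>2) * indicator B t \<partial>lborel)"
    unfolding ennreal_L2_norm_sq[OF L2] by (intro nn_integral_cong) (simp add: indicator_def)
qed

lemma L2_inner_mult_indicator:
  fixes f h :: "real ^ 'd \<Rightarrow> complex"
  assumes "f \<in> L2" "h \<in> L2" and [measurable]: "B \<in> sets borel"
    and supp: "AE t in lborel. h t \<noteq> 0 \<longrightarrow> t \<in> B"
  shows "L2_inner (\<lambda>t. f t * indicator B t) h = L2_inner f h"
proof -
  note [measurable] = L2_borel_measurable[OF \<open>f \<in> L2\<close>] L2_borel_measurable[OF \<open>h \<in> L2\<close>]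
  show ?thesis
    unfolding L2_inner_def
  proof (rule integral_cong_AE)
    show "AE t in lborel. f t * indicator B t * cnj (h t) = f t * cnj (h t)"
      using supp by eventually_elim (auto simp: indicator_def)
  qed measurable
qed

text \<open>Atoms supported in \<open>B\<close> have the same inner products with \<open>f\<close>
  and with its restriction to \<open>B\<close>, so the upper frame bound can be applied to the
  restriction.\<close>

lemma frame_infsum_on_le:
  fixes \<phi> :: "'k \<Rightarrow> real ^ 'd \<Rightarrow> complex"
  assumes frame: "frame K \<phi> A' A" and "X \<subseteq> K" and f: "f \<in> L2" and B: "B \<in> sets borel"
    and supp: "\<And>k. k \<in> X \<Longrightarrow> AE t in lborel. \<phi> k t \<noteq> 0 \<longrightarrow> t \<in> B"
  shows "(\<Sum>\<^sub>\<infinity>k\<in>X. ennreal ((cmod (L2_inner f (\<phi> k)))\<^sup>2))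
    \<le> ennreal A * (\<integral>\<^sup>+t. ennreal ((cmod (f t))\<^sup>2) * indicator B t \<partial>lborel)"
proof -
  let ?f = "\<lambda>t. f t * indicator B t"
  have "(\<Sum>\<^sub>\<infinity>k\<in>X. ennreal ((cmod (L2_inner f (\<phi> k)))\<^sup>2))
      = (\<Sum>\<^sub>\<infinity>k\<in>X. ennreal ((cmod (L2_inner ?f (\<phi> k)))\<^sup>2))"
    using frame \<open>X \<subseteq> K\<close> by (intro infsum_cong) (auto simp: frame_def L2_inner_mult_indicator[OF f _ B supp])
  also have "\<dots> \<le> (\<Sum>\<^sub>\<infinity>k\<in>K. ennreal ((cmod (L2_inner ?f (\<phi> k)))\<^sup>2))"
    using \<open>X \<subseteq> K\<close> by (intro infsum_mono_neutral nonneg_summable_on_complete) auto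
  also have "\<dots> \<le> ennreal (A * (L2_norm ?f)\<^sup>2)"
    using frame L2_mult_indicator(1)[OF f B] by (simp add: frame_def upper_frame_bound_def)
  also have "\<dots> = ennreal A * (\<integral>\<^sup>+t. ennreal ((cmod (f t))\<^sup>2) * indicator B t \<partial>lborel)"
    using frame by (simp add: L2_mult_indicator(2)[OF f B, symmetric] ennreal_mult frame_def upper_frame_bound_def)
  finally show ?thesis .
qed

text \<open>
  Tightness gives \<open>A \<parallel>f\<parallel>\<^sup>2 = A \<parallel>f 1\<^sub>F\<parallel>\<^sup>2 + A \<parallel>f 1\<^sub>-\<^sub>F\<parallel>\<^sup>2\<close>, and the coefficients of \<open>f\<close> and \<open>f 1\<^sub>-\<^sub>F\<close>
  outside \<open>X\<close> agree.
\<close>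

lemma tight_frame_infsum_on_ge:
  fixes \<phi> :: "'k \<Rightarrow> real ^ 'd \<Rightarrow> complex"
  assumes tight: "tight_frame K \<phi> A" and X: "X \<subseteq> K" and f: "f \<in> L2" and F: "F \<in> sets borel"
    and vanish: "\<And>k. k \<in> K - X \<Longrightarrow> AE t in lborel. t \<in> F \<longrightarrow> \<phi> k t = 0"
  shows "ennreal A * (\<integral>\<^sup>+t. ennreal ((cmod (f t))\<^sup>2) * indicator F t \<partial>lborel)
    \<le> (\<Sum>\<^sub>\<infinity>k\<in>X. ennreal ((cmod (L2_inner f (\<phi> k)))\<^sup>2))"
proof -
  note [measurable] = L2_borel_measurable[OF f] F
  have frame: "frame K \<phi> A A" using tight by (simp add: tight_frame_def)
  let ?c = "\<lambda>k. ennreal ((cmod (L2_inner f (\<phi> k)))\<^sup>2)"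
  let ?I = "\<lambda>B. ennreal A * (\<integral>\<^sup>+t. ennreal ((cmod (f t))\<^sup>2) * indicator B t \<partial>lborel)"
  \<comment> \<open>Finiteness of the part over the complement permits its cancellation at the
    end.\<close>
  have fin: "?I (- F) \<noteq> \<infinity>"
    using F by (subst L2_mult_indicator(2)[OF f, symmetric]) (auto simp: ennreal_mult_eq_top_iff)
  have "?I F + ?I (- F) = ennreal A * (\<integral>\<^sup>+t. ennreal ((cmod (f t))\<^sup>2) \<partial>lborel)"
    by (subst distrib_left[symmetric], subst nn_integral_add[symmetric])
       (auto intro!: arg_cong[where f="(*) (ennreal A)"] nn_integral_cong simp: indicator_def)
  also have "\<dots> = ennreal (A * (L2_norm f)\<^sup>2)"
    using frame by (simp add: ennreal_L2_norm_sq[OF f, symmetric] ennreal_mult frame_def lower_frame_bound_def)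
  also have "\<dots> \<le> (\<Sum>\<^sub>\<infinity>k\<in>K. ?c k)"
    using frame f by (simp add: frame_def lower_frame_bound_def)
  also have "\<dots> = (\<Sum>\<^sub>\<infinity>k\<in>X. ?c k) + (\<Sum>\<^sub>\<infinity>k\<in>K - X. ?c k)"
    using X by (subst infsum_Un_disjoint[symmetric]) (auto simp: Un_absorb1 intro!: nonneg_summable_on_complete)
  also have "(\<Sum>\<^sub>\<infinity>k\<in>K - X. ?c k) \<le> ?I (- F)"
  proof (rule frame_infsum_on_le[OF frame _ f])
    show "AE t in lborel. \<phi> k t \<noteq> 0 \<longrightarrow> t \<in> - F" if "k \<in> K - X" for k
      using vanish[OF that] by eventually_elim auto
  qed (use F in auto)
  finally have "?I (- F) + ?I F \<le> ?I (- F) + (\<Sum>\<^sub>\<infinity>k\<in>X. ?c k)"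
    by (simp add: add.commute add_left_mono)
  then show ?thesis
    using fin by (simp add: ennreal_add_left_cancel_le)
qed

section \<open>Families of balls with bounded overlap\<close>

lemma countable_index_if_ball_overlap:
  fixes x :: "'i \<Rightarrow> real ^ 'd"
  assumes overlap: "ball_overlap I x R 0 n" and R: "\<And>r. r \<in> I \<Longrightarrow> 0 < R r"
  shows "countable I"
proof -
  obtain D :: "(real ^ 'd) set" where D: "countable D" "\<And>S. open S \<Longrightarrow> S \<noteq> {} \<Longrightarrow> \<exists>d\<in>D. d \<in> S"
    by (rule countable_dense_setE) blast
  have "finite {r\<in>I. d \<in> ball (x r) (R r)}" for d
  proof (cases "\<exists>r\<in>I. d \<in> ball (x r) (R r)")
    case True
    then obtain r where r: "r \<in> I" "d \<in> ball (x r) (R r)" by auto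
    have "finite {s\<in>I. ball (x r) (R r + 0) \<inter> ball (x s) (R s + 0) \<noteq> {}}"
      using overlap r(1) by (simp add: ball_overlap_def)
    then show ?thesis
      by (rule finite_subset[rotated]) (use r in auto)
  next
    case False
    then have "{r\<in>I. d \<in> ball (x r) (R r)} = {}" by blast
    then show ?thesis by (metis finite.emptyI)
  qed
  moreover have "I \<subseteq> (\<Union>d\<in>D. {r\<in>I. d \<in> ball (x r) (R r)})"
  proof
    fix r assume "r \<in> I"
    with D(2)[of "ball (x r) (R r)"] R[of r]
    show "r \<in> (\<Union>d\<in>D. {r\<in>I. d \<in> ball (x r) (R r)})" by auto
  qed
  ultimately show ?thesis
    using D(1) by (meson countable_UN countable_finite countable_subset)
qed

text \<open>All balls that contain \<open>t\<close> meet any fixed one of them, so the overlap bound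
  of that ball counts them.\<close>

lemma nn_integral_indicator_balls_le:
  fixes x :: "'i \<Rightarrow> real ^ 'd"
  assumes overlap: "ball_overlap I x R \<rho> N"
  shows "(\<integral>\<^sup>+r. indicator (ball (x r) (R r + \<rho>)) t \<partial>count_space I) \<le> of_nat N"
proof (cases "\<exists>r\<in>I. t \<in> ball (x r) (R r + \<rho>)")
  case True
  then obtain r where r: "r \<in> I" "t \<in> ball (x r) (R r + \<rho>)" by auto
  let ?S = "{s\<in>I. ball (x r) (R r + \<rho>) \<inter> ball (x s) (R s + \<rho>) \<noteq> {}}"
  have S: "finite ?S" "card ?S \<le> N"
    using overlap r(1) by (auto simp: ball_overlap_def)
  have "(\<integral>\<^sup>+r. indicator (ball (x r) (R r + \<rho>)) t \<partial>count_space I)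
      = (\<Sum>s\<in>?S. indicator (ball (x s) (R s + \<rho>)) t :: ennreal)"
    by (rule nn_integral_count_space'[OF S(1)]) (use r in \<open>auto simp: indicator_def\<close>)
  also have "\<dots> \<le> (\<Sum>s\<in>?S. 1)"
    by (intro sum_mono) (auto simp: indicator_def)
  also have "\<dots> \<le> of_nat N"
    using S(2) by simp
  finally show ?thesis .
next
  case False
  then have "(\<integral>\<^sup>+r. indicator (ball (x r) (R r + \<rho>)) t \<partial>count_space I) = (\<integral>\<^sup>+r. 0 \<partial>count_space I)"
    by (intro nn_integral_cong) (auto simp: indicator_def)
  then show ?thesis by simp
qed

text \<open>The normalization \<open>1 \<le> A j\<close> fixes the scale of the windows: shrinking
  all of them lowers the frame sums but raises the constant in the claim. The upper bound is stated
  for retained atoms that live within a fixed distance \<open>\<rho>\<close> of the balls, because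
  the vanishing condition constrains only the discarded atoms. Wide strips could otherwise retain
  atoms at one place for infinitely many indices.\<close>

theorem proposition1:
  fixes g :: "'j \<Rightarrow> real ^ 'd \<Rightarrow> complex"
    and \<alpha> \<beta> A :: "'j \<Rightarrow> real"
    and J :: "'j set" and I :: "'i set" and m :: "'i \<Rightarrow> 'j"
    and x :: "'i \<Rightarrow> real ^ 'd" and R :: "'i \<Rightarrow> real"
    and \<psi> :: "'i \<Rightarrow> real ^ 'd \<Rightarrow> real"
    and nl nu :: "'i \<Rightarrow> int ^ 'd"
    and X :: "'i \<Rightarrow> ((real ^ 'd) \<times> (real ^ 'd)) set"
    and Cg C\<Lambda> :: real and n0 :: nat
  assumes "\<And>j. j \<in> J \<Longrightarrow> 0 < \<alpha> j" and "\<And>j. j \<in> J \<Longrightarrow> 0 < \<beta> j"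
    and tight: "\<And>j. j \<in> J \<Longrightarrow> tight_frame (tf_lattice (\<alpha> j) (\<beta> j)) (\<lambda>z. tf_shift z (g j)) (A j)"
    and normalization: "\<And>j. j \<in> J \<Longrightarrow> 1 \<le> A j"
    and "\<And>j. j \<in> J \<Longrightarrow> compactly_supported (g j)"
    and "\<And>j. j \<in> J \<Longrightarrow> g j \<in> S0"
    and "(SUP j\<in>J. S0_norm (g j)) = ennreal Cg"
    and "\<And>j. j \<in> J \<Longrightarrow> (1 / \<alpha> j + 1) ^ CARD('d) * (1 / \<beta> j + 1) ^ CARD('d) \<le> C\<Lambda>"
    and "partition_of_unity I x R \<psi> n0"
    and "\<And>r. r \<in> I \<Longrightarrow> compact (closure {t. \<psi> r t \<noteq> 0})"
    and standing: "\<And>\<rho>. 0 < \<rho> \<Longrightarrow> \<exists>N. ball_overlap I x R \<rho> N"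
    and "m \<in> I \<rightarrow> J"
    and "\<And>r. r \<in> I \<Longrightarrow> X r = tf_strip (\<alpha> (m r)) (\<beta> (m r)) (nl r) (nu r)"
    and "\<And>r n k. r \<in> I \<Longrightarrow> n \<notin> {nl r..nu r} \<Longrightarrow>
           AE t in lborel. complex_of_real (\<psi> r t) *
             tf_shift (\<alpha> (m r) *\<^sub>R int_vec n, \<beta> (m r) *\<^sub>R int_vec k) (g (m r)) t = 0"
  shows "lower_frame_bound (SIGMA r:I. X r) (\<lambda>(r, z). tf_shift z (g (m r)))
           (1 / (real n0 * C\<Lambda> * Cg\<^sup>2)) \<and>
         ((\<exists>\<rho>>0. \<forall>r\<in>I. \<forall>z\<in>X r. AE t in lborel.
             tf_shift z (g (m r)) t \<noteq> 0 \<longrightarrow> t \<in> ball (x r) (R r + \<rho>)) \<longrightarrow>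
          (\<exists>B. frame (SIGMA r:I. X r) (\<lambda>(r, z). tf_shift z (g (m r)))
             (1 / (real n0 * C\<Lambda> * Cg\<^sup>2)) B))"
proof -
  note pos = assms(1,2) and supp = assms(5) and S0 = assms(6) and Cg = assms(7)
    and C\<Lambda> = assms(8) and pou = assms(9) and mJ = assms(12) and X = assms(13) and vanish = assms(14)
  have m: "m r \<in> J" if "r \<in> I" for r
    using mJ that by auto

  \<comment> \<open>Covering and index set\<close>
  have overlap: "ball_overlap I x R 0 n0" and sum1: "\<And>t. ((\<lambda>r. \<psi> r t) has_sum 1) I"
    and R: "\<And>r. r \<in> I \<Longrightarrow> 0 < R r"
    using pou by (auto simp: partition_of_unity_def)
  have cover: "\<exists>r\<in>I. \<psi> r t \<noteq> 0" for t
  proof (rule ccontr)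
    assume "\<not> (\<exists>r\<in>I. \<psi> r t \<noteq> 0)"
    then have "((\<lambda>r. \<psi> r t) has_sum 0) I" by (intro has_sum_0) auto
    with sum1[of t] show False using has_sum_unique by fastforce
  qed
  then obtain r0 where r0: "r0 \<in> I" by blast
  have countable: "countable I"
    using overlap R by (rule countable_index_if_ball_overlap)
  have n0: "1 \<le> n0"
  proof -
    define S where "S = {s\<in>I. ball (x r0) (R r0 + 0) \<inter> ball (x s) (R s + 0) \<noteq> {}}"
    have "finite S" "card S \<le> n0"
      using overlap r0 unfolding ball_overlap_def S_def by blast+
    moreover have "r0 \<in> S" unfolding S_def using r0 R[OF r0] by auto
    ultimately have "0 < card S" using card_gt_0_iff by blast
    with \<open>card S \<le> n0\<close> show ?thesis by linarith
  qed

  \<comment> \<open>Comparison of the constants\<close>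
  define M where "M = C\<Lambda> * Cg\<^sup>2"
  have gL2: "g j \<in> L2" if "j \<in> J" for j
    using S0[OF that] by (simp add: S0_def)
  have A_le: "A j \<le> M" and Cg_pos: "0 < Cg" and C\<Lambda>_pos: "0 < C\<Lambda>" if j: "j \<in> J" for j
  proof -
    let ?p = "(\<alpha> j * \<beta> j) ^ CARD('d)"
    have p: "0 < ?p" using pos[OF j] by simp
    \<comment> \<open>\<open>ennreal\<close> sends negative reals to 0, so the estimate is first
      made with \<open>max 0 Cg\<close>. Since the left-hand side of \<open>le\<close> is positive,
      \<open>Cg\<close> must be positive.\<close>
    have "S0_norm (g j) \<le> ennreal (max 0 Cg)"
      using j unfolding ennreal_max_0 Cg[symmetric] by (rule SUP_upper)
    then have le: "A j * ?p \<le> (max 0 Cg)\<^sup>2"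
      using pos[OF j] tight[OF j] gL2[OF j] supp[OF j]
      by (intro lower_frame_bound_le_S0_norm[of _ _ "g j"]) (auto simp: tight_frame_def frame_def)
    have "0 < A j * ?p" using p normalization[OF j] by simp
    with le have "0 < (max 0 Cg)\<^sup>2" by linarith
    then show "0 < Cg" by (simp add: max_def split: if_splits)
    \<comment> \<open>The identity \<open>1 + a = a * (1 / a + 1)\<close>, used for
      \<open>\<alpha> j\<close> and \<open>\<beta> j\<close>, shows that \<open>C\<Lambda>\<close>
      compensates the volume \<open>?p\<close> of the fundamental box.\<close>
    have "1 \<le> (1 + \<alpha> j) ^ CARD('d) * (1 + \<beta> j) ^ CARD('d)"
      using pos[OF j] by (intro mult_ge1_I one_le_power) auto
    also have "\<dots> = ?p * ((1 / \<alpha> j + 1) ^ CARD('d) * (1 / \<beta> j + 1) ^ CARD('d))"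
      using pos[OF j] by (simp add: field_simps flip: power_mult_distrib)
    also have "\<dots> \<le> ?p * C\<Lambda>"
      using p C\<Lambda>[OF j] by simp
    finally have pC: "1 \<le> ?p * C\<Lambda>" .
    with p show C: "0 < C\<Lambda>"
      by (smt (verit) mult_nonneg_nonpos)
    have "A j * 1 \<le> A j * (?p * C\<Lambda>)"
      using pC normalization[OF j] by (intro mult_left_mono) auto
    also have "\<dots> = C\<Lambda> * (A j * ?p)" by (simp only: mult_ac)
    also have "\<dots> \<le> M"
      unfolding M_def using le C \<open>0 < Cg\<close> by (intro mult_left_mono) (auto simp: max_def)
    finally show "A j \<le> M" by simp
  qed
  note Cg_pos = Cg_pos[OF m[OF r0]] and C\<Lambda>_pos = C\<Lambda>_pos[OF m[OF r0]]
  have M: "1 \<le> M" using A_le[OF m[OF r0]] normalization[OF m[OF r0]] by simp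
  define D where "D = 1 / (real n0 * C\<Lambda> * Cg\<^sup>2)"
  \<comment> \<open>The claimed bound is the reciprocal of \<open>real n0 * M\<close>, hence at most
    1, and it is enough to prove the lower frame inequality with constant 1.\<close>
  have "1 \<le> real n0 * M" using n0 M by (intro mult_ge1_I) auto
  then have D: "0 < D" "D \<le> 1"
    using n0 Cg_pos C\<Lambda>_pos unfolding D_def M_def by (auto simp: mult.assoc)
  let ?c = "\<lambda>f r z. ennreal ((cmod (L2_inner f (tf_shift z (g (m r)))))\<^sup>2)"
  let ?E = "\<lambda>f B. \<integral>\<^sup>+t. ennreal ((cmod (f t))\<^sup>2) * indicator B t \<partial>lborel"
  have lattice: "X r \<subseteq> tf_lattice (\<alpha> (m r)) (\<beta> (m r))" if "r \<in> I" for r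
    using X[OF that] by (auto simp: tf_strip_def tf_lattice_def)
  have infsum_Sigma: "(\<Sum>\<^sub>\<infinity>k\<in>(SIGMA r:I. X r). ennreal ((cmod (L2_inner f
      ((\<lambda>(r, z). tf_shift z (g (m r))) k)))\<^sup>2)) = (\<integral>\<^sup>+r. (\<Sum>\<^sub>\<infinity>z\<in>X r. ?c f r z) \<partial>count_space I)" for f
    using countable_subset[OF lattice countable_tf_lattice]
    by (simp add: infsum_Sigma_ennreal[OF countable])

  \<comment> \<open>The sets on which the discarded atoms vanish\<close>
  define F where "F r = {t. \<forall>n. n \<notin> {nl r..nu r} \<longrightarrow> g (m r) (t - \<alpha> (m r) *\<^sub>R int_vec n) = 0}" for r
  \<comment> \<open>Modulations have modulus 1, so only the position index \<open>n\<close> enters,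
    and the set is a countable intersection of measurable ones.\<close>
  have F_meas: "F r \<in> sets borel" if "r \<in> I" for r
  proof -
    note [measurable] = L2_borel_measurable[OF gL2[OF m[OF that]]]
    show ?thesis unfolding F_def by measurable
  qed
  have F_cover: "AE t in lborel. \<exists>r\<in>I. t \<in> F r"
  proof -
    have "AE t in lborel. \<psi> r t \<noteq> 0 \<longrightarrow> t \<in> F r" if "r \<in> I" for r
    proof -
      \<comment> \<open>Frequency index 0 represents all frequencies. There are countably many
        \<open>n\<close>, so their null sets can be merged into one.\<close>
      have "AE t in lborel. \<forall>n. n \<notin> {nl r..nu r} \<longrightarrow> complex_of_real (\<psi> r t) *
          tf_shift (\<alpha> (m r) *\<^sub>R int_vec n, \<beta> (m r) *\<^sub>R int_vec 0) (g (m r)) t = 0"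
        unfolding AE_all_countable using vanish[OF that] by (auto intro: AE_impI)
      then show ?thesis
        by eventually_elim (auto simp: F_def tf_shift_def)
    qed
    then have "AE t in lborel. \<forall>r\<in>I. \<psi> r t \<noteq> 0 \<longrightarrow> t \<in> F r"
      using countable by (simp add: AE_ball_countable)
    then show ?thesis
      by eventually_elim (use cover in blast)
  qed

  \<comment> \<open>Lower frame bound\<close>
  have lower: "lower_frame_bound (SIGMA r:I. X r) (\<lambda>(r, z). tf_shift z (g (m r))) D"
    unfolding lower_frame_bound_def infsum_Sigma
  proof (intro conjI ballI D(1))
    fix f :: "real ^ 'd \<Rightarrow> complex" assume f: "f \<in> L2"
    note [measurable] = L2_borel_measurable[OF f]
    have "ennreal (D * (L2_norm f)\<^sup>2) \<le> ennreal ((L2_norm f)\<^sup>2)"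
      using D by (intro ennreal_leI mult_left_le_one_le) auto
    also have "\<dots> = (\<integral>\<^sup>+t. ennreal ((cmod (f t))\<^sup>2) \<partial>lborel)"
      by (rule ennreal_L2_norm_sq[OF f])
    also have "\<dots> \<le> (\<integral>\<^sup>+t. (\<integral>\<^sup>+r. ennreal ((cmod (f t))\<^sup>2) * indicator (F r) t \<partial>count_space I) \<partial>lborel)"
    proof (rule nn_integral_mono_AE, use F_cover in eventually_elim)
      case (elim t)
      then obtain r where r: "r \<in> I" "t \<in> F r" by auto
      then have "ennreal ((cmod (f t))\<^sup>2) = ennreal ((cmod (f t))\<^sup>2) * indicator (F r) t" by simp
      also have "\<dots> \<le> (\<integral>\<^sup>+r. ennreal ((cmod (f t))\<^sup>2) * indicator (F r) t \<partial>count_space I)"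
        using r(1) by (rule nn_integral_ge_point)
      finally show ?case .
    qed
    also have "\<dots> = (\<integral>\<^sup>+r. ?E f (F r) \<partial>count_space I)"
    proof (rule nn_integral_count_space_nn_integral[OF countable])
      fix r assume "r \<in> I"
      note [measurable] = F_meas[OF this]
      show "(\<lambda>t. ennreal ((cmod (f t))\<^sup>2) * indicator (F r) t) \<in> borel_measurable lborel"
        by measurable
    qed
    also have "\<dots> \<le> (\<integral>\<^sup>+r. (\<Sum>\<^sub>\<infinity>z\<in>X r. ?c f r z) \<partial>count_space I)"
    proof (intro nn_integral_mono)
      fix r assume "r \<in> space (count_space I)"
      then have r: "r \<in> I" by simp
      \<comment> \<open>Here the normalization of the tight frame bounds enters.\<close>
      have "1 * ?E f (F r) \<le> ennreal (A (m r)) * ?E f (F r)"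
        using normalization[OF m[OF r]] by (intro mult_right_mono) auto
      also have "\<dots> \<le> (\<Sum>\<^sub>\<infinity>z\<in>X r. ?c f r z)"
      proof (rule tight_frame_infsum_on_ge[OF tight[OF m[OF r]] lattice[OF r] f F_meas[OF r]])
        fix z assume "z \<in> tf_lattice (\<alpha> (m r)) (\<beta> (m r)) - X r"
        then obtain n k where z: "z = (\<alpha> (m r) *\<^sub>R int_vec n, \<beta> (m r) *\<^sub>R int_vec k)"
            "n \<notin> {nl r..nu r}"
          by (auto simp: X[OF r] tf_lattice_def tf_strip_def)
        then show "AE t in lborel. t \<in> F r \<longrightarrow> tf_shift z (g (m r)) t = 0"
          by (auto simp: F_def tf_shift_def)
      qed
      finally show "?E f (F r) \<le> (\<Sum>\<^sub>\<infinity>z\<in>X r. ?c f r z)" by simp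
    qed
    finally show "ennreal (D * (L2_norm f)\<^sup>2) \<le> (\<integral>\<^sup>+r. (\<Sum>\<^sub>\<infinity>z\<in>X r. ?c f r z) \<partial>count_space I)" .
  qed

  \<comment> \<open>Upper frame bound\<close>
  have upper: "\<exists>B. upper_frame_bound (SIGMA r:I. X r) (\<lambda>(r, z). tf_shift z (g (m r))) B"
    if \<rho>: "0 < \<rho>" and near: "\<forall>r\<in>I. \<forall>z\<in>X r. AE t in lborel.
      tf_shift z (g (m r)) t \<noteq> 0 \<longrightarrow> t \<in> ball (x r) (R r + \<rho>)" for \<rho>
  proof -
    obtain N where N: "ball_overlap I x R \<rho> N" using standing[OF \<rho>] by auto
    let ?B = "\<lambda>r. ball (x r) (R r + \<rho>)"
    \<comment> \<open>\<open>M\<close> bounds all the tight frame bounds, and \<open>N\<close>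
      bounds the number of enlarged balls containing a point. The added 1 makes positivity
      immediate.\<close>
    have "upper_frame_bound (SIGMA r:I. X r) (\<lambda>(r, z). tf_shift z (g (m r))) (M * (real N + 1))"
      unfolding upper_frame_bound_def infsum_Sigma
    proof (intro conjI ballI)
      show "0 < M * (real N + 1)" using M by simp
      fix f :: "real ^ 'd \<Rightarrow> complex" assume f: "f \<in> L2"
      note [measurable] = L2_borel_measurable[OF f]
      have "(\<integral>\<^sup>+r. (\<Sum>\<^sub>\<infinity>z\<in>X r. ?c f r z) \<partial>count_space I) \<le> (\<integral>\<^sup>+r. ennreal M * ?E f (?B r) \<partial>count_space I)"
      proof (intro nn_integral_mono)
        fix r assume "r \<in> space (count_space I)"
        then have r: "r \<in> I" by simp
        have "(\<Sum>\<^sub>\<infinity>z\<in>X r. ?c f r z) \<le> ennreal (A (m r)) * ?E f (?B r)"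
          using tight[OF m[OF r]] lattice[OF r] near r
          by (intro frame_infsum_on_le[OF _ _ f]) (auto simp: tight_frame_def)
        also have "\<dots> \<le> ennreal M * ?E f (?B r)"
          using A_le[OF m[OF r]] by (intro mult_right_mono ennreal_leI) auto
        finally show "(\<Sum>\<^sub>\<infinity>z\<in>X r. ?c f r z) \<le> ennreal M * ?E f (?B r)" .
      qed
      also have "\<dots> = ennreal M * (\<integral>\<^sup>+r. ?E f (?B r) \<partial>count_space I)"
        by (rule nn_integral_cmult) simp
      also have "(\<integral>\<^sup>+r. ?E f (?B r) \<partial>count_space I)
          = (\<integral>\<^sup>+t. (\<integral>\<^sup>+r. ennreal ((cmod (f t))\<^sup>2) * indicator (?B r) t \<partial>count_space I) \<partial>lborel)"
      proof (rule nn_integral_count_space_nn_integral[OF countable, symmetric])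
        fix r assume "r \<in> I"
        have [measurable]: "?B r \<in> sets borel" by simp
        show "(\<lambda>t. ennreal ((cmod (f t))\<^sup>2) * indicator (?B r) t) \<in> borel_measurable lborel"
          by measurable
      qed
      \<comment> \<open>After the interchange the inner integral counts the enlarged balls that
        contain \<open>t\<close>.\<close>
      also have "\<dots> = (\<integral>\<^sup>+t. ennreal ((cmod (f t))\<^sup>2) * (\<integral>\<^sup>+r. indicator (?B r) t \<partial>count_space I) \<partial>lborel)"
        by (intro nn_integral_cong nn_integral_cmult) simp
      also have "\<dots> \<le> (\<integral>\<^sup>+t. ennreal ((cmod (f t))\<^sup>2) * ennreal (real N + 1) \<partial>lborel)"
      proof (intro nn_integral_mono mult_left_mono)
        fix t
        have "(\<integral>\<^sup>+r. indicator (?B r) t \<partial>count_space I) \<le> of_nat N"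
          by (rule nn_integral_indicator_balls_le[OF N])
        also have "\<dots> \<le> ennreal (real N + 1)"
          by (simp add: ennreal_of_nat_eq_real_of_nat)
        finally show "(\<integral>\<^sup>+r. indicator (?B r) t \<partial>count_space I) \<le> ennreal (real N + 1)" .
      qed simp
      also have "\<dots> = ennreal ((L2_norm f)\<^sup>2) * ennreal (real N + 1)"
        by (simp add: nn_integral_multc ennreal_L2_norm_sq[OF f])
      also have "ennreal M * \<dots> = ennreal (M * ((L2_norm f)\<^sup>2 * (real N + 1)))"
        by (simp only: ennreal_mult' zero_le_power2 order_trans[OF zero_le_one M])
      also have "\<dots> = ennreal (M * (real N + 1) * (L2_norm f)\<^sup>2)"
        by (simp only: mult_ac)
      finally show "(\<integral>\<^sup>+r. (\<Sum>\<^sub>\<infinity>z\<in>X r. ?c f r z) \<partial>count_space I)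
          \<le> ennreal (M * (real N + 1) * (L2_norm f)\<^sup>2)"
        by (simp add: mult_left_mono)
    qed
    then show ?thesis by blast
  qed
  have "\<forall>k\<in>(SIGMA r:I. X r). (\<lambda>(r, z). tf_shift z (g (m r))) k \<in> L2"
    using L2_tf_shift(1)[OF gL2[OF m]] by auto
  with lower upper show ?thesis
    unfolding D_def frame_def by blast
qed

end
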